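(* Let $f:M\to M$ be a homeomorphism of a compact finite-dimensional manifold $M$, let $\mu$ be an $f$-invariant probability measure with $h_\mu(f)<\infty$, and let $\mathscr A$ be a measurable partition of $M$ with $H_\mu(\mathscr A)<\infty$. Suppose that $\mu$ is $\mathscr A$-expansive. Then $$h_\mu(f)=h_\mu(f,\mathscr A).$$
   Context: $\mathscr A(x)$ denotes the element of $\mathscr A$ containing $x$. The $\infty$ $\mathscr A$-ball of $x$ is $\mathscr A^\infty(x)=\bigcap_{n\in\mathbb Z}f^{-n}\mathscr A(f^n(x))$, and the $\mathscr A$-tail entropy of $x$ is $h_{tail}(f,x,\mathscr A)=h_{top}(\mathscr A^\infty(x),f)$, where for $E\subset M$, $h_{top}(E,f)=\lim_{\delta\to0}\limsup_{n\to\infty}\frac1n\log r_n(\delta,E)$ and $r_n(\delta,E)$ is the minimal cardinality of an $(n,\delta)$-spanning set for $E$ (Bowen). The measure $\mu$ is $\mathscr A$-expansive if $h_{tail}(f,x,\mathscr A)=0$ for $\mu$-almost every $x$. $H_\mu(\mathscr A)=-\sum_{A\in\mathscr A}\mu(A)\log\mu(A)$, and $h_\mu(f,\mathscr A)$ is the entropy of $f$ with respect to $\mathscr A$. *)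

theory Defs
  imports "HOL-Probability.Probability"
begin

definition topological_manifold :: "nat \<Rightarrow> 'a topology \<Rightarrow> bool" where
  "topological_manifold n X \<longleftrightarrow>
     Hausdorff_space X \<and> second_countable X \<and>
     (\<forall>x\<in>topspace X. \<exists>U V. openin X U \<and> x \<in> U \<and> openin (Euclidean_space n) V \<and>
        subtopology X U homeomorphic_space subtopology (Euclidean_space n) V)"

text \<open>The element of the partition \<open>\<A>\<close> that contains \<open>x\<close>.\<close>

definition atom :: "'a set set \<Rightarrow> 'a \<Rightarrow> 'a set" where
  "atom \<A> x = (THE A. A \<in> \<A> \<and> x \<in> A)"

text \<open>Measurable partitions in the sense of Rokhlin: off a null set, two points lie in the same
  element if and only if no member of some fixed countable family of measurable sets separates
  them. Every countable partition into measurable sets is of this kind, but uncountable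
  partitions are admitted as well.\<close>

definition measurable_partition :: "'a measure \<Rightarrow> 'a set set \<Rightarrow> bool" where
  "measurable_partition \<mu> \<A> \<longleftrightarrow>
     partition_on (space \<mu>) \<A> \<and> \<A> \<subseteq> sets \<mu> \<and>
     (\<exists>N\<in>null_sets \<mu>. \<exists>\<S>. countable \<S> \<and> \<S> \<subseteq> sets \<mu> \<and>
        (\<forall>x\<in>space \<mu> - N. \<forall>y\<in>space \<mu> - N.
           atom \<A> x = atom \<A> y \<longleftrightarrow> (\<forall>S\<in>\<S>. x \<in> S \<longleftrightarrow> y \<in> S)))"

text \<open>The sum only sees elements of positive measure. If these do not cover the space up to
  a null set (for instance for the partition of the unit interval into points), the entropy is
  infinite by convention; for countable partitions this case does not arise.\<close>

definition partition_entropy :: "'a measure \<Rightarrow> 'a set set \<Rightarrow> ennreal" where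
  "partition_entropy \<mu> \<A> =
     (if AE x in \<mu>. 0 < measure \<mu> (atom \<A> x)
      then \<Sum>\<^sub>\<infinity>A\<in>\<A>. ennreal (- (measure \<mu> A * ln (measure \<mu> A)))
      else \<infinity>)"

text \<open>The join of the partitions \<open>f\<^sup>-\<^sup>i \<A>\<close> for \<open>0 \<le> i < n\<close>; its elements are the nonempty
  intersections of one element from each of them.\<close>

definition dynamical_join :: "'a set \<Rightarrow> ('a \<Rightarrow> 'a) \<Rightarrow> 'a set set \<Rightarrow> nat \<Rightarrow> 'a set set" where
  "dynamical_join M f \<A> n =
     (\<lambda>a. {x \<in> M. \<forall>i<n. (f ^^ i) x \<in> a i}) ` ({..<n} \<rightarrow>\<^sub>E \<A>) - {{}}"

definition entropy_wrt :: "'a measure \<Rightarrow> ('a \<Rightarrow> 'a) \<Rightarrow> 'a set set \<Rightarrow> ennreal" where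
  "entropy_wrt \<mu> f \<A> =
     lim (\<lambda>n. partition_entropy \<mu> (dynamical_join (space \<mu>) f \<A> n) / of_nat n)"

definition metric_entropy :: "'a measure \<Rightarrow> ('a \<Rightarrow> 'a) \<Rightarrow> ennreal" where
  "metric_entropy \<mu> f = (SUP \<P>\<in>{\<P>. finite \<P> \<and> measurable_partition \<mu> \<P>}. entropy_wrt \<mu> f \<P>)"

text \<open>As in Bowen's definition, the points of a spanning set for \<open>E\<close> need not belong to \<open>E\<close>.\<close>

definition spanning_set ::
  "'a::metric_space set \<Rightarrow> ('a \<Rightarrow> 'a) \<Rightarrow> nat \<Rightarrow> real \<Rightarrow> 'a set \<Rightarrow> 'a set \<Rightarrow> bool" where
  "spanning_set M f n \<delta> E F \<longleftrightarrow>
     F \<subseteq> M \<and> (\<forall>x\<in>E. \<exists>y\<in>F. \<forall>k<n. dist ((f ^^ k) x) ((f ^^ k) y) \<le> \<delta>)"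

definition min_spanning ::
  "'a::metric_space set \<Rightarrow> ('a \<Rightarrow> 'a) \<Rightarrow> nat \<Rightarrow> real \<Rightarrow> 'a set \<Rightarrow> nat" where
  "min_spanning M f n \<delta> E = Inf (card ` {F. finite F \<and> spanning_set M f n \<delta> E F})"

definition top_entropy :: "'a::metric_space set \<Rightarrow> ('a \<Rightarrow> 'a) \<Rightarrow> 'a set \<Rightarrow> ereal" where
  "top_entropy M f E =
     Lim (at_right 0) (\<lambda>\<delta>. limsup (\<lambda>n. ereal (ln (real (min_spanning M f n \<delta> E)) / real n)))"

definition int_iterate :: "'a set \<Rightarrow> ('a \<Rightarrow> 'a) \<Rightarrow> int \<Rightarrow> 'a \<Rightarrow> 'a" where
  "int_iterate M f n = (if 0 \<le> n then f ^^ nat n else inv_into M f ^^ nat (- n))"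

definition infinity_ball :: "'a set \<Rightarrow> ('a \<Rightarrow> 'a) \<Rightarrow> 'a set set \<Rightarrow> 'a \<Rightarrow> 'a set" where
  "infinity_ball M f \<A> x =
     (\<Inter>n. {y \<in> M. int_iterate M f n y \<in> atom \<A> (int_iterate M f n x)})"

definition tail_entropy ::
  "'a::metric_space set \<Rightarrow> ('a \<Rightarrow> 'a) \<Rightarrow> 'a \<Rightarrow> 'a set set \<Rightarrow> ereal" where
  "tail_entropy M f x \<A> = top_entropy M f (infinity_ball M f \<A> x)"

definition expansive_measure ::
  "'a::metric_space measure \<Rightarrow> ('a \<Rightarrow> 'a) \<Rightarrow> 'a set set \<Rightarrow> bool" where
  "expansive_measure \<mu> f \<A> \<longleftrightarrow> (AE x in \<mu>. tail_entropy (space \<mu>) f x \<A> = 0)"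

end

theory Submission
  imports Defs
begin

text \<open>
  Entropies of partitions are treated as entropies of random variables with countably many values:
  since \<open>\<A>\<close> has finite entropy, almost every point lies in an element of positive measure, and
  there are only countably many of these. Let \<open>a\<close> be the label of the element that contains a point.

  The entropy with respect to \<open>\<A>\<close> is at most the entropy of the map, because \<open>a\<close> is determined by
  a truncation of \<open>a\<close> to finitely many values up to arbitrarily small conditional entropy
  (\<open>cond_ent_truncate_small\<close>).

  For the converse let \<open>p\<close> be the label of a finite partition. Divide a long orbit into
  blocks of length \<open>N\<close>. Each block of the \<open>p\<close>-name costs at most the conditional entropy of the \<open>p\<close>-name
  of length \<open>N\<close> given the labels \<open>a\<close> at the times from \<open>- k\<close> to \<open>k\<close> relative to the start of the block
  (\<open>ent_names_block_le\<close>). Therefore it suffices that for every \<open>\<epsilon> > 0\<close> this conditional entropy is at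
  most \<open>\<epsilon> N\<close> for some \<open>N\<close> and \<open>k\<close>.

  As \<open>k\<close> tends to infinity, the points with the same labels \<open>a\<close> as \<open>x\<close> shrink to a subset of the
  \<open>\<infinity>\<close> ball of \<open>x\<close>, for almost every \<open>x\<close>. By expansiveness this set is spanned, at any scale \<open>\<delta>\<close>, by
  \<open>exp (o(N))\<close> points. Up to a set \<open>B\<close> of exceptional labels, carried by a set of small measure, the
  level sets of \<open>p\<close> have distance more than \<open>2 \<delta>\<close>, so points that stay close together for time
  \<open>N\<close> have the same name except at the times with a label in \<open>B\<close>, and these are a small proportion
  for most points by Markov's inequality. So only few names occur in the \<open>\<infinity>\<close> ball
  (\<open>card_names_spanned\<close>).

  To pass from the \<open>\<infinity>\<close> ball to finite \<open>k\<close>, restrict to a compact set of almost full measure on which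
  all the labels and names are continuous (\<open>lusin\<close>). There a name that occurs for each \<open>k\<close> occurs in the
  limit, by compactness, so for large \<open>k\<close> no further names occur. Gibbs' inequality, applied to
  the uniform distribution on the names that occur, gives the bound (\<open>cond_ent_names_small\<close>).
\<close>

section \<open>Conditional entropy of discrete random variables\<close>

context prob_space
begin

abbreviation discrete_rv :: "('a \<Rightarrow> 'b::countable) \<Rightarrow> bool" where
  "discrete_rv X \<equiv> X \<in> measurable M (count_space UNIV)"

definition pr :: "('a \<Rightarrow> 'b) \<Rightarrow> 'b \<Rightarrow> real" where
  "pr X v = prob {x \<in> space M. X x = v}"

text \<open>The integrand is the conditional information \<open>- ln P(X = X x | Y = Y x)\<close> of the point \<open>x\<close>.
  Working with the integral of a pointwise quantity makes the chain rule and the monotonicity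
  properties pointwise statements. The junk values of \<open>ln\<close> and of the division at 0 only occur on a null set, by \<open>AE_pr_pos\<close>.\<close>

definition cond_ent :: "('a \<Rightarrow> 'b) \<Rightarrow> ('a \<Rightarrow> 'c) \<Rightarrow> ennreal" where
  "cond_ent X Y =
     (\<integral>\<^sup>+x. ennreal (ln (pr Y (Y x) / pr (\<lambda>x. (X x, Y x)) (X x, Y x))) \<partial>M)"

definition ent :: "('a \<Rightarrow> 'b) \<Rightarrow> ennreal" where
  "ent X = (\<integral>\<^sup>+x. ennreal (- ln (pr X (X x))) \<partial>M)"

lemma pr_nonneg [simp]: "0 \<le> pr X v" and pr_le_1 [simp]: "pr X v \<le> 1"
  by (auto simp: pr_def)

lemma discrete_rv_level:
  fixes X :: "'a \<Rightarrow> 'b::countable"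
  assumes X: "discrete_rv X" shows "{x \<in> space M. X x = v} \<in> events"
  using measurable_sets[OF X, of "{v}"] by (auto simp: vimage_def Int_def conj_commute)

lemma discrete_rv_Pair:
  fixes X :: "'a \<Rightarrow> 'b::countable" and Y :: "'a \<Rightarrow> 'c::countable"
  assumes "discrete_rv X" "discrete_rv Y"
  shows "discrete_rv (\<lambda>x. (X x, Y x))"
proof -
  have "(\<lambda>x. (X x, Y x)) \<in> measurable M (count_space UNIV \<Otimes>\<^sub>M count_space UNIV)"
    using assms by simp
  then show ?thesis
    by (simp add: pair_measure_countable)
qed

lemma discrete_rv_fun:
  fixes X :: "'a \<Rightarrow> 'b::countable"
  assumes X: "discrete_rv X" and \<phi>: "\<And>v. \<phi> v \<in> space N"
  shows "(\<lambda>x. \<phi> (X x)) \<in> measurable M N"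
  using \<phi> by (intro measurable_compose[OF X]) auto

lemma pr_mono:
  fixes Y :: "'a \<Rightarrow> 'b::countable"
  assumes "discrete_rv Y" "\<And>y. y \<in> space M \<Longrightarrow> X y = v \<Longrightarrow> Y y = w"
  shows "pr X v \<le> pr Y w"
  unfolding pr_def using discrete_rv_level[OF assms(1)] assms(2)
  by (intro finite_measure_mono) auto

text \<open>A variable with countably many values takes those of probability zero only on a countable union
  of null sets.\<close>

lemma AE_pr_pos:
  fixes X :: "'a \<Rightarrow> 'b::countable"
  assumes X: "discrete_rv X" shows "AE x in M. 0 < pr X (X x)"
proof -
  have "AE x in M. pr X v = 0 \<longrightarrow> X x \<noteq> v" for v
  proof (cases "pr X v = 0")
    case True
    then show ?thesis
      using discrete_rv_level[OF X] by (auto simp: pr_def prob_eq_0)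
  qed auto
  then have "AE x in M. \<forall>v. pr X v = 0 \<longrightarrow> X x \<noteq> v"
    by (simp add: AE_all_countable)
  then show ?thesis
    by (rule eventually_mono) (metis pr_nonneg less_eq_real_def)
qed

lemma nn_integral_discrete_rv:
  fixes X :: "'a \<Rightarrow> 'b::countable"
  assumes X: "discrete_rv X"
  shows "(\<integral>\<^sup>+x. \<phi> (X x) \<partial>M) = (\<integral>\<^sup>+v. \<phi> v * ennreal (pr X v) \<partial>count_space UNIV)"
proof -
  have "(\<integral>\<^sup>+x. \<phi> (X x) \<partial>M) =
      (\<integral>\<^sup>+x. (\<integral>\<^sup>+v. \<phi> v * indicator {y \<in> space M. X y = v} x \<partial>count_space UNIV) \<partial>M)"
  proof (intro nn_integral_cong)
    fix x assume x: "x \<in> space M"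
    have "(\<integral>\<^sup>+v. \<phi> v * indicator {y \<in> space M. X y = v} x \<partial>count_space UNIV) =
        (\<integral>\<^sup>+v. \<phi> v * indicator {X x} v \<partial>count_space UNIV)"
      using x by (intro nn_integral_cong) (auto split: split_indicator)
    also have "\<dots> = \<phi> (X x)"
      by (subst nn_integral_count_space'[of "{X x}"]) auto
    finally show "\<phi> (X x) =
        (\<integral>\<^sup>+v. \<phi> v * indicator {y \<in> space M. X y = v} x \<partial>count_space UNIV)" ..
  qed
  also have "\<dots> =
      (\<integral>\<^sup>+v. (\<integral>\<^sup>+x. \<phi> v * indicator {y \<in> space M. X y = v} x \<partial>M) \<partial>count_space UNIV)"
    using discrete_rv_level[OF X] by (intro nn_integral_count_space_nn_integral) auto
  also have "\<dots> = (\<integral>\<^sup>+v. \<phi> v * ennreal (pr X v) \<partial>count_space UNIV)"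
    using discrete_rv_level[OF X]
    by (intro nn_integral_cong) (simp add: nn_integral_cmult_indicator pr_def emeasure_eq_measure)
  finally show ?thesis .
qed

lemma sum_pr:
  fixes X :: "'a \<Rightarrow> 'b::countable"
  assumes "discrete_rv X" shows "(\<integral>\<^sup>+v. ennreal (pr X v) \<partial>count_space UNIV) = 1"
  using nn_integral_discrete_rv[OF assms, of "\<lambda>_. 1"] by (simp add: emeasure_space_1)

lemma sum_pr_Pair:
  fixes X :: "'a \<Rightarrow> 'b::countable" and Y :: "'a \<Rightarrow> 'c::countable"
  assumes X: "discrete_rv X" and Y: "discrete_rv Y"
  shows "(\<integral>\<^sup>+v. ennreal (pr (\<lambda>x. (X x, Y x)) (v, w)) \<partial>count_space UNIV) = ennreal (pr Y w)"
proof -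
  have "(\<integral>\<^sup>+v. ennreal (pr (\<lambda>x. (X x, Y x)) (v, w)) \<partial>count_space UNIV) =
      (\<integral>\<^sup>+v. emeasure M {x \<in> space M. (X x, Y x) = (v, w)} \<partial>count_space UNIV)"
    by (simp add: pr_def emeasure_eq_measure)
  also have "\<dots> = emeasure M (\<Union>v. {x \<in> space M. (X x, Y x) = (v, w)})"
    using discrete_rv_level[OF discrete_rv_Pair[OF X Y]]
    by (intro emeasure_UN_countable[symmetric]) (auto simp: disjoint_family_on_def)
  also have "(\<Union>v. {x \<in> space M. (X x, Y x) = (v, w)}) = {x \<in> space M. Y x = w}"
    by auto
  finally show ?thesis by (simp add: pr_def emeasure_eq_measure)
qed

text \<open>Any guess \<open>q\<close> for the conditional distribution of \<open>X\<close> given \<open>Y\<close> costs at least as much as the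
  true one. The proof integrates \<open>ln t \<le> t - 1\<close>, where \<open>t\<close> is the ratio of the guess to
  the true conditional probability: the integral of \<open>t\<close> is at most 1. This one inequality yields
  both that conditioning reduces entropy, by guessing from less information, and all upper bounds
  of entropies by counting, by guessing uniform distributions.\<close>

lemma gibbs_inequality:
  fixes X :: "'a \<Rightarrow> 'b::countable" and Y :: "'a \<Rightarrow> 'c::countable" and q :: "'b \<Rightarrow> 'c \<Rightarrow> real"
  assumes X: "discrete_rv X" and Y: "discrete_rv Y"
    and q1: "\<And>w. (\<integral>\<^sup>+v. ennreal (q v w) \<partial>count_space UNIV) \<le> 1"
    and q0: "AE x in M. 0 < q (X x) (Y x)"
  shows "cond_ent X Y \<le> (\<integral>\<^sup>+x. ennreal (- ln (q (X x) (Y x))) \<partial>M)"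
proof -
  define XY where "XY x = (X x, Y x)" for x
  have XY: "discrete_rv XY"
    unfolding XY_def by (intro discrete_rv_Pair X Y)
  have q_le1: "q v w \<le> 1" for v w
  proof -
    have "ennreal (q v w) \<le> (\<integral>\<^sup>+v. ennreal (q v w) \<partial>count_space UNIV)"
      by (rule nn_integral_ge_point) auto
    also have "\<dots> \<le> 1" by (rule q1)
    finally show ?thesis
      by (simp add: ennreal_le_1)
  qed
  define R where "R u = ennreal (pr Y (snd u) / pr XY u * q (fst u) (snd u))" for u
  have R1: "(\<integral>\<^sup>+x. R (XY x) \<partial>M) \<le> 1"
  proof -
    have "(\<integral>\<^sup>+x. R (XY x) \<partial>M) = (\<integral>\<^sup>+u. R u * ennreal (pr XY u) \<partial>count_space UNIV)"
      by (rule nn_integral_discrete_rv[OF XY])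
    also have "\<dots> \<le> (\<integral>\<^sup>+u. ennreal (pr Y (snd u)) * ennreal (q (fst u) (snd u)) \<partial>count_space UNIV)"
    proof (intro nn_integral_mono)
      fix u
      show "R u * ennreal (pr XY u) \<le> ennreal (pr Y (snd u)) * ennreal (q (fst u) (snd u))"
      proof (cases "q (fst u) (snd u) \<le> 0 \<or> pr XY u = 0")
        case True
        then have "R u * ennreal (pr XY u) = 0"
          by (auto simp: R_def ennreal_neg mult_nonneg_nonpos divide_nonpos_nonneg)
        then show ?thesis by (simp only: zero_le)
      next
        case False
        then have "R u * ennreal (pr XY u) = ennreal (pr Y (snd u) / pr XY u * q (fst u) (snd u) * pr XY u)"
          unfolding R_def by (subst ennreal_mult) auto
        also have "pr Y (snd u) / pr XY u * q (fst u) (snd u) * pr XY u = pr Y (snd u) * q (fst u) (snd u)"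
          using False by simp
        finally show ?thesis
          using False by (simp add: ennreal_mult)
      qed
    qed
    also have "\<dots> = (\<integral>\<^sup>+w. (\<integral>\<^sup>+v. ennreal (pr Y w) * ennreal (q v w) \<partial>count_space UNIV) \<partial>count_space UNIV)"
      by (subst nn_integral_snd_count_space[symmetric]) simp
    also have "\<dots> = (\<integral>\<^sup>+w. ennreal (pr Y w) * (\<integral>\<^sup>+v. ennreal (q v w) \<partial>count_space UNIV) \<partial>count_space UNIV)"
      by (simp add: nn_integral_cmult)
    also have "\<dots> \<le> (\<integral>\<^sup>+w. ennreal (pr Y w) * 1 \<partial>count_space UNIV)"
      by (intro nn_integral_mono mult_left_mono q1) auto
    also have "\<dots> = 1" by (simp add: sum_pr[OF Y])
    finally show ?thesis .
  qed
  have meas: "(\<lambda>x. \<psi> (XY x)) \<in> borel_measurable M" for \<psi> :: "_ \<Rightarrow> ennreal"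
    by (rule discrete_rv_fun[OF XY]) auto
  \<comment> \<open>The inequality is integrated in the form \<open>ln A + 1 \<le> - ln q + A * q\<close>, in which all terms are
    nonnegative; the finite constant 1 cancels at the end even if the entropies are infinite.\<close>
  have "cond_ent X Y + 1 =
      (\<integral>\<^sup>+x. ennreal (ln (pr Y (Y x) / pr XY (XY x))) \<partial>M) + (\<integral>\<^sup>+x. 1 \<partial>M)"
    by (simp add: cond_ent_def XY_def[abs_def] emeasure_space_1)
  also have "\<dots> = (\<integral>\<^sup>+x. ennreal (ln (pr Y (Y x) / pr XY (XY x))) + 1 \<partial>M)"
    using meas[of "\<lambda>u. ennreal (ln (pr Y (snd u) / pr XY u))"]
    by (subst nn_integral_add) (auto simp: XY_def)
  also have "\<dots> \<le> (\<integral>\<^sup>+x. ennreal (- ln (q (X x) (Y x))) + R (XY x) \<partial>M)"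
  proof (rule nn_integral_mono_AE)
    show "AE x in M. ennreal (ln (pr Y (Y x) / pr XY (XY x))) + 1
        \<le> ennreal (- ln (q (X x) (Y x))) + R (XY x)"
      using q0 AE_pr_pos[OF XY]
    proof eventually_elim
      case (elim x)
      define A where "A = pr Y (Y x) / pr XY (XY x)"
      have "pr XY (XY x) \<le> pr Y (Y x)"
        by (intro pr_mono Y) (auto simp: XY_def)
      with elim have A: "A \<ge> 1" by (simp add: A_def)
      define B where "B = q (X x) (Y x)"
      have B: "0 < B" "B \<le> 1" using elim q_le1 by (auto simp: B_def)
      have "ln (A * B) \<le> A * B - 1"
        using A B by (intro ln_le_minus_one) auto
      then have *: "ln A + 1 \<le> - ln B + A * B"
        using A B by (simp add: ln_mult)
      have "ennreal (ln A) + 1 = ennreal (ln A + 1)"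
        using A by (simp add: ennreal_plus)
      also have "\<dots> \<le> ennreal (- ln B + A * B)"
        using * by (rule ennreal_leI)
      also have "\<dots> = ennreal (- ln B) + ennreal (A * B)"
        using A B by (intro ennreal_plus) auto
      finally show ?case
        by (simp add: A_def B_def R_def XY_def)
    qed
  qed
  also have "\<dots> = (\<integral>\<^sup>+x. ennreal (- ln (q (X x) (Y x))) \<partial>M) + (\<integral>\<^sup>+x. R (XY x) \<partial>M)"
    using meas[of "\<lambda>u. ennreal (- ln (q (fst u) (snd u)))"] meas[of R]
    by (subst nn_integral_add) (auto simp: XY_def)
  also have "\<dots> \<le> (\<integral>\<^sup>+x. ennreal (- ln (q (X x) (Y x))) \<partial>M) + 1"
    using R1 by (intro add_left_mono)
  finally show ?thesis
    by (simp add: ennreal_add_left_cancel_le add.commute)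
qed

text \<open>If \<open>Z\<close> determines \<open>Y\<close>, say \<open>Y = \<phi> \<circ> Z\<close>, then the conditional distribution of \<open>X\<close> given
  \<open>Y = \<phi> w\<close> is an admissible guess for that given \<open>Z = w\<close>.\<close>

lemma cond_ent_antimono:
  fixes X :: "'a \<Rightarrow> 'b::countable" and Y :: "'a \<Rightarrow> 'c::countable" and Z :: "'a \<Rightarrow> 'd::countable"
  assumes X: "discrete_rv X" and Y: "discrete_rv Y" and Z: "discrete_rv Z"
    and det: "\<And>x y. x \<in> space M \<Longrightarrow> y \<in> space M \<Longrightarrow> Z x = Z y \<Longrightarrow> Y x = Y y"
  shows "cond_ent X Z \<le> cond_ent X Y"
proof -
  define \<phi> where "\<phi> w = Y (SOME x. x \<in> space M \<and> Z x = w)" for w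
  have \<phi>: "\<phi> (Z x) = Y x" if "x \<in> space M" for x
  proof -
    have "(SOME y. y \<in> space M \<and> Z y = Z x) \<in> space M \<and>
        Z (SOME y. y \<in> space M \<and> Z y = Z x) = Z x"
      by (rule someI[of _ x]) (simp add: that)
    then show ?thesis
      unfolding \<phi>_def by (intro det that) auto
  qed
  define XY where "XY x = (X x, Y x)" for x
  have XY: "discrete_rv XY"
    unfolding XY_def by (intro discrete_rv_Pair X Y)
  define q where "q v w = pr XY (v, \<phi> w) / pr Y (\<phi> w)" for v w
  have "cond_ent X Z \<le> (\<integral>\<^sup>+x. ennreal (- ln (q (X x) (Z x))) \<partial>M)"
  proof (rule gibbs_inequality[OF X Z])
    fix w
    have "(\<integral>\<^sup>+v. ennreal (q v w) \<partial>count_space UNIV) =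
        (\<integral>\<^sup>+v. ennreal (1 / pr Y (\<phi> w)) * ennreal (pr XY (v, \<phi> w)) \<partial>count_space UNIV)"
      by (intro nn_integral_cong) (simp add: q_def ennreal_mult[symmetric])
    also have "\<dots> = ennreal (1 / pr Y (\<phi> w)) * ennreal (pr Y (\<phi> w))"
      using sum_pr_Pair[OF X Y] by (simp add: nn_integral_cmult XY_def[abs_def])
    also have "\<dots> \<le> 1"
      by (simp add: ennreal_mult[symmetric] ennreal_le_1)
    finally show "(\<integral>\<^sup>+v. ennreal (q v w) \<partial>count_space UNIV) \<le> 1" .
  next
    show "AE x in M. 0 < q (X x) (Z x)"
      using AE_pr_pos[OF XY] AE_pr_pos[OF Y] AE_space
      by eventually_elim (auto simp: q_def \<phi> XY_def)
  qed
  also have "\<dots> = cond_ent X Y"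
    unfolding cond_ent_def
  proof (rule nn_integral_cong_AE)
    show "AE x in M. ennreal (- ln (q (X x) (Z x))) =
        ennreal (ln (pr Y (Y x) / pr (\<lambda>x. (X x, Y x)) (X x, Y x)))"
      using AE_pr_pos[OF XY] AE_pr_pos[OF Y] AE_space
    proof eventually_elim
      case (elim x)
      have "- ln (q (X x) (Z x)) = ln (pr Y (Y x) / pr XY (XY x))"
        using elim unfolding q_def \<phi>[OF elim(3)] XY_def by (simp add: ln_div)
      then show ?case by (simp add: XY_def[abs_def])
    qed
  qed
  finally show ?thesis .
qed

text \<open>A coarser variable has larger level sets, hence pointwise less information.\<close>

lemma cond_ent_mono:
  fixes X :: "'a \<Rightarrow> 'b::countable" and Y :: "'a \<Rightarrow> 'c::countable" and Z :: "'a \<Rightarrow> 'd::countable"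
  assumes X: "discrete_rv X" and Y: "discrete_rv Y" and Z: "discrete_rv Z"
    and det: "\<And>x y. x \<in> space M \<Longrightarrow> y \<in> space M \<Longrightarrow> Y x = Y y \<Longrightarrow> X x = X y"
  shows "cond_ent X Z \<le> cond_ent Y Z"
  unfolding cond_ent_def
proof (rule nn_integral_mono_AE)
  show "AE x in M. ennreal (ln (pr Z (Z x) / pr (\<lambda>x. (X x, Z x)) (X x, Z x)))
      \<le> ennreal (ln (pr Z (Z x) / pr (\<lambda>x. (Y x, Z x)) (Y x, Z x)))"
    using AE_pr_pos[OF discrete_rv_Pair[OF X Z]] AE_pr_pos[OF discrete_rv_Pair[OF Y Z]]
      AE_pr_pos[OF Z] AE_space
  proof eventually_elim
    case (elim x)
    have "pr (\<lambda>x. (Y x, Z x)) (Y x, Z x) \<le> pr (\<lambda>x. (X x, Z x)) (X x, Z x)"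
    proof (intro pr_mono discrete_rv_Pair X Z)
      fix y assume "y \<in> space M" "(Y y, Z y) = (Y x, Z x)"
      with det[OF this(1) elim(4)] show "(X y, Z y) = (X x, Z x)" by simp
    qed
    with elim show ?case
      by (intro ennreal_leI) (simp add: ln_div)
  qed
qed

lemma ent_eq_cond_ent: "ent X = cond_ent X (\<lambda>_. ())"
proof -
  have 1: "pr (\<lambda>_. ()) () = 1"
    using prob_space by (simp add: pr_def)
  have "pr (\<lambda>x. (X x, ())) (v, ()) = pr X v" for v
    by (simp add: pr_def)
  moreover have "ln (1 / t) = - ln t" for t :: real
    by (simp add: inverse_eq_divide[symmetric] ln_inverse)
  ultimately show ?thesis
    by (simp only: ent_def cond_ent_def 1)
qed

lemma ent_mono:
  fixes X :: "'a \<Rightarrow> 'b::countable" and Y :: "'a \<Rightarrow> 'c::countable"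
  assumes "discrete_rv X" "discrete_rv Y"
    and "\<And>x y. x \<in> space M \<Longrightarrow> y \<in> space M \<Longrightarrow> Y x = Y y \<Longrightarrow> X x = X y"
  shows "ent X \<le> ent Y"
  unfolding ent_eq_cond_ent by (intro cond_ent_mono assms) auto

lemma cond_ent_le_ent:
  fixes X :: "'a \<Rightarrow> 'b::countable" and Y :: "'a \<Rightarrow> 'c::countable"
  assumes "discrete_rv X" "discrete_rv Y"
  shows "cond_ent X Y \<le> ent X"
  unfolding ent_eq_cond_ent using assms by (intro cond_ent_antimono) auto

text \<open>The chain rule holds pointwise for the information functions.\<close>

lemma cond_ent_chain:
  fixes X :: "'a \<Rightarrow> 'b::countable" and Y :: "'a \<Rightarrow> 'c::countable" and Z :: "'a \<Rightarrow> 'd::countable"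
  assumes X: "discrete_rv X" and Y: "discrete_rv Y" and Z: "discrete_rv Z"
  shows "cond_ent (\<lambda>x. (X x, Y x)) Z = cond_ent X Z + cond_ent Y (\<lambda>x. (X x, Z x))"
proof -
  define XZ where "XZ x = (X x, Z x)" for x
  define YXZ where "YXZ x = (Y x, XZ x)" for x
  have XZ: "discrete_rv XZ"
    unfolding XZ_def by (intro discrete_rv_Pair X Z)
  have YXZ: "discrete_rv YXZ"
    unfolding YXZ_def by (intro discrete_rv_Pair Y XZ)
  have meas: "(\<lambda>x. \<psi> (YXZ x)) \<in> borel_measurable M" for \<psi> :: "_ \<Rightarrow> ennreal"
    by (rule discrete_rv_fun[OF YXZ]) auto
  have eq: "pr (\<lambda>x. ((X x, Y x), Z x)) ((X x, Y x), Z x) = pr YXZ (YXZ x)" for x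
    unfolding pr_def YXZ_def XZ_def by (rule arg_cong[where f = prob]) auto
  have "cond_ent (\<lambda>x. (X x, Y x)) Z = (\<integral>\<^sup>+x. ennreal (ln (pr Z (Z x) / pr YXZ (YXZ x))) \<partial>M)"
    unfolding cond_ent_def eq ..
  also have "\<dots> = (\<integral>\<^sup>+x. ennreal (ln (pr Z (Z x) / pr XZ (XZ x))) +
      ennreal (ln (pr XZ (XZ x) / pr YXZ (YXZ x))) \<partial>M)"
  proof (rule nn_integral_cong_AE)
    show "AE x in M. ennreal (ln (pr Z (Z x) / pr YXZ (YXZ x))) =
        ennreal (ln (pr Z (Z x) / pr XZ (XZ x))) + ennreal (ln (pr XZ (XZ x) / pr YXZ (YXZ x)))"
      using AE_pr_pos[OF Z] AE_pr_pos[OF XZ] AE_pr_pos[OF YXZ]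
    proof eventually_elim
      case (elim x)
      have "pr XZ (XZ x) \<le> pr Z (Z x)" "pr YXZ (YXZ x) \<le> pr XZ (XZ x)"
        by (intro pr_mono Z XZ; simp add: XZ_def YXZ_def)+
      with elim show ?case
        by (subst ennreal_plus[symmetric]) (auto simp: ln_div)
    qed
  qed
  also have "\<dots> = cond_ent X Z + cond_ent Y XZ"
    using meas[of "\<lambda>u. ennreal (ln (pr Z (snd (snd u)) / pr XZ (snd u)))"]
      meas[of "\<lambda>u. ennreal (ln (pr XZ (snd u) / pr YXZ u))"]
    by (subst nn_integral_add) (auto simp: cond_ent_def YXZ_def[abs_def] XZ_def[abs_def])
  finally show ?thesis unfolding XZ_def[abs_def] .
qed

lemma cond_ent_Pair_le:
  fixes X :: "'a \<Rightarrow> 'b::countable" and Y :: "'a \<Rightarrow> 'c::countable" and Z :: "'a \<Rightarrow> 'd::countable"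
  assumes X: "discrete_rv X" and Y: "discrete_rv Y" and Z: "discrete_rv Z"
  shows "cond_ent (\<lambda>x. (X x, Y x)) Z \<le> cond_ent X Z + cond_ent Y Z"
  unfolding cond_ent_chain[OF assms]
  by (intro add_left_mono cond_ent_antimono Y Z discrete_rv_Pair X) auto

lemma ent_Pair:
  fixes X :: "'a \<Rightarrow> 'b::countable" and Y :: "'a \<Rightarrow> 'c::countable"
  assumes X: "discrete_rv X" and Y: "discrete_rv Y"
  shows "ent (\<lambda>x. (X x, Y x)) = ent X + cond_ent Y X"
proof -
  have unit: "discrete_rv (\<lambda>_. ())" by simp
  have "cond_ent Y (\<lambda>x. (X x, ())) = cond_ent Y X"
    by (intro antisym cond_ent_antimono X Y discrete_rv_Pair unit) auto
  then show ?thesis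
    unfolding ent_eq_cond_ent cond_ent_chain[OF X Y unit] by simp
qed

lemma ent_le_ln_card:
  fixes X :: "'a \<Rightarrow> 'b::countable"
  assumes X: "discrete_rv X" and "finite S" "\<And>x. x \<in> space M \<Longrightarrow> X x \<in> S"
  shows "ent X \<le> ennreal (ln (card S))"
proof -
  from not_empty assms have S: "card S > 0" by (auto simp: card_gt_0_iff)
  define q :: "'b \<Rightarrow> unit \<Rightarrow> real" where "q v w = (if v \<in> S then 1 / real (card S) else 0)" for v w
  have "ent X \<le> (\<integral>\<^sup>+x. ennreal (- ln (q (X x) ())) \<partial>M)"
    unfolding ent_eq_cond_ent
  proof (rule gibbs_inequality[OF X])
    fix w
    have "(\<integral>\<^sup>+v. ennreal (q v w) \<partial>count_space UNIV) = (\<Sum>v\<in>S. ennreal (q v w))"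
      using \<open>finite S\<close> unfolding q_def by (intro nn_integral_count_space') auto
    also have "\<dots> = 1"
      using S by (simp add: q_def ennreal_of_nat_eq_real_of_nat ennreal_mult[symmetric])
    finally show "(\<integral>\<^sup>+v. ennreal (q v w) \<partial>count_space UNIV) \<le> 1" by simp
  qed (use assms S in \<open>auto simp: q_def\<close>)
  also have "\<dots> = (\<integral>\<^sup>+x. ennreal (ln (card S)) \<partial>M)"
    using assms S by (intro nn_integral_cong) (auto simp: q_def ln_div)
  also have "\<dots> = ennreal (ln (card S))"
    by (simp add: emeasure_space_1)
  finally show ?thesis .
qed

section \<open>Names along orbits of a measure-preserving map\<close>

definition mpt :: "('a \<Rightarrow> 'a) \<Rightarrow> bool" where
  "mpt T \<longleftrightarrow> T \<in> measurable M M \<and> distr M M T = M"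

lemma mpt_compose: "mpt S \<Longrightarrow> mpt T \<Longrightarrow> mpt (S \<circ> T)"
  unfolding mpt_def by (metis distr_distr measurable_comp)

lemma mpt_id: "mpt (\<lambda>x. x)"
  by (simp add: mpt_def distr_id)

lemma mpt_funpow: "mpt T \<Longrightarrow> mpt (T ^^ n)"
  by (induction n) (simp_all add: mpt_compose mpt_id id_def)

lemma mpt_measurable: "mpt T \<Longrightarrow> T \<in> measurable M M"
  by (simp add: mpt_def)

lemma mpt_discrete_rv: "mpt T \<Longrightarrow> discrete_rv X \<Longrightarrow> discrete_rv (\<lambda>x. X (T x))"
  by (auto intro: measurable_compose simp: mpt_def)

lemma mpt_AE: "mpt T \<Longrightarrow> AE x in M. P x \<Longrightarrow> AE x in M. P (T x)"
  unfolding mpt_def by (metis AE_distrD)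

lemma pr_mpt:
  fixes X :: "'a \<Rightarrow> 'b::countable"
  assumes T: "mpt T" and X: "discrete_rv X"
  shows "pr (\<lambda>x. X (T x)) v = pr X v"
proof -
  have "prob {x \<in> space M. X x = v} = measure (distr M M T) {x \<in> space M. X x = v}"
    using T by (simp add: mpt_def)
  also have "\<dots> = prob (T -` {x \<in> space M. X x = v} \<inter> space M)"
    using T discrete_rv_level[OF X] by (intro measure_distr) (auto simp: mpt_def)
  also have "T -` {x \<in> space M. X x = v} \<inter> space M = {x \<in> space M. X (T x) = v}"
    using mpt_measurable[OF T] by (auto dest: measurable_space)
  finally show ?thesis by (simp add: pr_def)
qed

lemma cond_ent_mpt:
  fixes X :: "'a \<Rightarrow> 'b::countable" and Y :: "'a \<Rightarrow> 'c::countable"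
  assumes T: "mpt T" and X: "discrete_rv X" and Y: "discrete_rv Y"
  shows "cond_ent (\<lambda>x. X (T x)) (\<lambda>x. Y (T x)) = cond_ent X Y"
proof -
  define XY where "XY x = (X x, Y x)" for x
  have XY: "discrete_rv XY"
    unfolding XY_def by (intro discrete_rv_Pair X Y)
  have meas: "(\<lambda>x. \<psi> (XY x)) \<in> borel_measurable M" for \<psi> :: "_ \<Rightarrow> ennreal"
    by (rule discrete_rv_fun[OF XY]) auto
  define F where "F x = ennreal (ln (pr Y (Y x) / pr XY (XY x)))" for x
  have F: "F \<in> borel_measurable M"
    using meas[of "\<lambda>u. ennreal (ln (pr Y (snd u) / pr XY u))"] by (simp add: F_def[abs_def] XY_def)
  have "cond_ent (\<lambda>x. X (T x)) (\<lambda>x. Y (T x)) = (\<integral>\<^sup>+x. F (T x) \<partial>M)"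
    using pr_mpt[OF T XY] pr_mpt[OF T Y] by (simp add: cond_ent_def F_def XY_def[abs_def])
  also have "\<dots> = (\<integral>\<^sup>+x. F x \<partial>distr M M T)"
    using F T by (subst nn_integral_distr) (auto simp: mpt_def)
  also have "\<dots> = cond_ent X Y"
    using T by (simp add: mpt_def cond_ent_def F_def XY_def[abs_def])
  finally show ?thesis .
qed

lemma ent_mpt:
  fixes X :: "'a \<Rightarrow> 'b::countable"
  assumes T: "mpt T" and X: "discrete_rv X"
  shows "ent (\<lambda>x. X (T x)) = ent X"
  unfolding ent_eq_cond_ent using cond_ent_mpt[OF T X, of "\<lambda>_. ()"] by simp

end

text \<open>The itinerary of \<open>x\<close> with respect to the labelling \<open>X\<close>. Its nonempty level sets are the elements of the
  join of the first \<open>n\<close> preimages of the partition into the level sets of \<open>X\<close>. Names are lists, not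
  functions on \<open>{..<n}\<close>, so that they again form a countable type.\<close>

primrec names :: "('a \<Rightarrow> 'a) \<Rightarrow> ('a \<Rightarrow> 'b) \<Rightarrow> nat \<Rightarrow> 'a \<Rightarrow> 'b list" where
  "names T X 0 x = []"
| "names T X (Suc n) x = X x # names T X n (T x)"

lemma length_names [simp]: "length (names T X n x) = n"
  by (induction n arbitrary: x) auto

lemma nth_names: "i < n \<Longrightarrow> names T X n x ! i = X ((T ^^ i) x)"
  by (induction n arbitrary: x i) (auto simp: nth_Cons funpow_Suc_right simp del: funpow.simps split: nat.split)

lemma names_eq_iff: "names T X n x = names T Y n y \<longleftrightarrow> (\<forall>i<n. X ((T ^^ i) x) = Y ((T ^^ i) y))"
  by (auto simp: list_eq_iff_nth_eq nth_names)

context prob_space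
begin

lemma discrete_rv_names:
  fixes X :: "'a \<Rightarrow> 'b::countable"
  assumes T: "mpt T" and X: "discrete_rv X"
  shows "discrete_rv (names T X n)"
proof (induction n)
  case (Suc n)
  have "discrete_rv (\<lambda>x. (X x, names T X n (T x)))"
    by (intro discrete_rv_Pair X mpt_discrete_rv[OF T] Suc)
  from discrete_rv_fun[OF this, of "\<lambda>(v, l). v # l" "count_space UNIV"]
  show ?case by (simp add: names.simps(2)[abs_def])
qed simp

text \<open>Each letter \<open>X (T\<^sup>i x)\<close> of the name is already predicted by the letter \<open>Y (T\<^sup>i x)\<close> with the same
  index, at the cost \<open>cond_ent X Y\<close> by invariance.\<close>

lemma cond_ent_names_le:
  fixes X :: "'a \<Rightarrow> 'b::countable" and Y :: "'a \<Rightarrow> 'c::countable"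
  assumes T: "mpt T" and X: "discrete_rv X" and Y: "discrete_rv Y"
  shows "cond_ent (names T X n) (names T Y n) \<le> of_nat n * cond_ent X Y"
proof (induction n)
  case 0
  have "ent (names T X 0) \<le> ennreal (ln (card {[] :: 'b list}))"
    by (intro ent_le_ln_card discrete_rv_names T X) auto
  with cond_ent_le_ent[OF discrete_rv_names[OF T X, of 0] discrete_rv_names[OF T Y, of 0]]
  show ?case by (simp add: names.simps(1)[abs_def])
next
  case (Suc n)
  note nX = discrete_rv_names[OF T X] and nY = discrete_rv_names[OF T Y]
  let ?Z = "names T Y (Suc n)"
  have "cond_ent (names T X (Suc n)) ?Z \<le> cond_ent (\<lambda>x. (X x, names T X n (T x))) ?Z"
    by (intro cond_ent_mono nX nY discrete_rv_Pair X mpt_discrete_rv[OF T]) auto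
  also have "\<dots> \<le> cond_ent X ?Z + cond_ent (\<lambda>x. names T X n (T x)) ?Z"
    by (intro cond_ent_Pair_le nX nY X mpt_discrete_rv[OF T])
  also have "\<dots> \<le> cond_ent X Y + cond_ent (\<lambda>x. names T X n (T x)) (\<lambda>x. names T Y n (T x))"
    by (intro add_mono cond_ent_antimono nX nY X Y mpt_discrete_rv[OF T]) auto
  also have "\<dots> = cond_ent X Y + cond_ent (names T X n) (names T Y n)"
    by (subst cond_ent_mpt[OF T nX nY]) simp
  also have "\<dots> \<le> cond_ent X Y + of_nat n * cond_ent X Y"
    by (intro add_left_mono Suc)
  also have "\<dots> = of_nat (Suc n) * cond_ent X Y"
    by (simp add: algebra_simps)
  finally show ?case .
qed

lemma ent_names_le:
  fixes X :: "'a \<Rightarrow> 'b::countable" and Y :: "'a \<Rightarrow> 'c::countable"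
  assumes T: "mpt T" and X: "discrete_rv X" and Y: "discrete_rv Y"
  shows "ent (names T X n) \<le> ent (names T Y n) + of_nat n * cond_ent X Y"
proof -
  note nX = discrete_rv_names[OF T X] and nY = discrete_rv_names[OF T Y]
  have "ent (names T X n) \<le> ent (\<lambda>x. (names T Y n x, names T X n x))"
    by (intro ent_mono nX nY discrete_rv_Pair) auto
  also have "\<dots> = ent (names T Y n) + cond_ent (names T X n) (names T Y n)"
    by (rule ent_Pair[OF nY nX])
  also have "\<dots> \<le> ent (names T Y n) + of_nat n * cond_ent X Y"
    by (intro add_left_mono cond_ent_names_le T X Y)
  finally show ?thesis .
qed

lemma ent_names_subadd:
  fixes X :: "'a \<Rightarrow> 'b::countable"
  assumes T: "mpt T" and X: "discrete_rv X"
  shows "ent (names T X (m + n)) \<le> ent (names T X m) + ent (names T X n)"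
proof -
  note nX = discrete_rv_names[OF T X] and Tm = mpt_funpow[OF T, of m]
  have "ent (names T X (m + n)) \<le> ent (\<lambda>x. (names T X m x, names T X n ((T ^^ m) x)))"
  proof (intro ent_mono nX discrete_rv_Pair mpt_discrete_rv[OF Tm])
    fix x y
    assume *: "(names T X m x, names T X n ((T ^^ m) x)) = (names T X m y, names T X n ((T ^^ m) y))"
    have "X ((T ^^ i) x) = X ((T ^^ i) y)" if "i < m + n" for i
    proof (cases "i < m")
      case False
      with that have "X ((T ^^ (i - m)) ((T ^^ m) x)) = X ((T ^^ (i - m)) ((T ^^ m) y))"
        using * by (auto simp: names_eq_iff)
      moreover have "(T ^^ (i - m)) ((T ^^ m) z) = (T ^^ i) z" for z
        using False by (metis comp_apply funpow_add le_add_diff_inverse2 not_less)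
      ultimately show ?thesis by simp
    qed (use * in \<open>auto simp: names_eq_iff\<close>)
    then show "names T X (m + n) x = names T X (m + n) y"
      by (auto simp: names_eq_iff)
  qed
  also have "\<dots> = ent (names T X m) + cond_ent (\<lambda>x. names T X n ((T ^^ m) x)) (names T X m)"
    by (intro ent_Pair nX mpt_discrete_rv[OF Tm])
  also have "\<dots> \<le> ent (names T X m) + ent (\<lambda>x. names T X n ((T ^^ m) x))"
    by (intro add_left_mono cond_ent_le_ent nX mpt_discrete_rv[OF Tm])
  also have "\<dots> = ent (names T X m) + ent (names T X n)"
    by (simp add: ent_mpt[OF Tm nX])
  finally show ?thesis .
qed

end

section \<open>Entropy rates\<close>

lemma subadditive_mult_le:
  fixes v :: "nat \<Rightarrow> real"
  assumes sub: "\<And>m n. v (m + n) \<le> v m + v n"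
  shows "v (q * m + r) \<le> real q * v m + v r"
proof (induction q)
  case (Suc q)
  have "v (Suc q * m + r) = v (m + (q * m + r))" by (simp add: algebra_simps)
  also have "\<dots> \<le> v m + v (q * m + r)" by (rule sub)
  finally show ?case using Suc by (simp add: algebra_simps)
qed simp

text \<open>Fekete's lemma.\<close>

lemma subadditive_convergent:
  fixes v :: "nat \<Rightarrow> real"
  assumes sub: "\<And>m n. v (m + n) \<le> v m + v n" and nonneg: "\<And>n. 0 \<le> v n"
  shows "\<exists>L\<ge>0. (\<lambda>n. v n / real n) \<longlonglongrightarrow> L"
proof -
  define L where "L = (INF n\<in>{1..}. v n / real n)"
  have bdd: "bdd_below ((\<lambda>n. v n / real n) ` {1..})"
    using nonneg by (intro bdd_belowI2[of _ 0]) auto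
  have L_le: "L \<le> v n / real n" if "n \<ge> 1" for n
    unfolding L_def using that by (intro cINF_lower bdd) auto
  have L0: "L \<ge> 0"
    unfolding L_def using nonneg by (intro cINF_greatest) auto
  have "(\<lambda>n. v n / real n) \<longlonglongrightarrow> L"
  proof (rule LIMSEQ_I)
    fix e :: real assume e: "e > 0"
    have "\<exists>m\<in>{1..}. v m / real m < L + e / 2"
      using e unfolding L_def by (subst cINF_less_iff[symmetric, OF _ bdd]) auto
    then obtain m where m: "m \<ge> 1" "v m / real m < L + e / 2" by auto
    define C where "C = (\<Sum>r<m. v r)"
    have C0: "C \<ge> 0" unfolding C_def using nonneg by (intro sum_nonneg) auto
    obtain N where N: "2 * C / e < real N" using reals_Archimedean2 by blast
    have "norm (v n / real n - L) < e" if n: "n \<ge> max N 1" for n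
    proof -
      have "v n = v (n div m * m + n mod m)" by simp
      also have "\<dots> \<le> real (n div m) * v m + v (n mod m)"
        by (rule subadditive_mult_le[OF sub])
      also have "v (n mod m) \<le> C"
        unfolding C_def using m nonneg by (intro member_le_sum) auto
      also have "real (n div m) \<le> real n / real m"
        by (rule of_nat_div_le_of_nat)
      finally have "v n \<le> real n / real m * v m + C"
        using nonneg[of m] by (simp add: mult_right_mono)
      then have "v n / real n \<le> v m / real m + C / real n"
        using n m by (simp add: field_simps)
      also have "C / real n < e / 2"
        using N n e by (simp add: field_simps) (smt (verit) mult_left_mono of_nat_mono)
      finally have "v n / real n < L + e" using m by linarith
      moreover have "L \<le> v n / real n" using n by (intro L_le) auto
      ultimately show ?thesis using e by auto
    qed
    then show "\<exists>no. \<forall>n\<ge>no. norm (v n / real n - L) < e" by blast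
  qed
  with L0 show ?thesis by blast
qed

context prob_space
begin

definition rate :: "('a \<Rightarrow> 'a) \<Rightarrow> ('a \<Rightarrow> 'b) \<Rightarrow> real" where
  "rate T X = lim (\<lambda>n. enn2real (ent (names T X n)) / real n)"

lemma ent_names_finite:
  fixes X :: "'a \<Rightarrow> 'b::countable"
  assumes T: "mpt T" and X: "discrete_rv X" and fin: "ent X < \<infinity>"
  shows "ent (names T X n) < \<infinity>"
proof (induction n)
  case 0
  have "ent (names T X 0) \<le> ennreal (ln (card {[] :: 'b list}))"
    by (intro ent_le_ln_card discrete_rv_names T X) auto
  also have "\<dots> < \<infinity>" by simp
  finally show ?case .
next
  case (Suc n)
  have "ent (names T X (Suc 0)) \<le> ent X"
    by (intro ent_mono discrete_rv_names T X) simp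
  then have "ent (names T X (n + Suc 0)) \<le> ent (names T X n) + ent X"
    by (rule order_trans[OF ent_names_subadd[OF T X] add_left_mono])
  also have "\<dots> < \<infinity>" using Suc fin by simp
  finally show ?case by (simp only: add_Suc_right add_0_right)
qed

lemma rate_LIMSEQ:
  fixes X :: "'a \<Rightarrow> 'b::countable"
  assumes T: "mpt T" and X: "discrete_rv X" and fin: "ent X < \<infinity>"
  shows "(\<lambda>n. enn2real (ent (names T X n)) / real n) \<longlonglongrightarrow> rate T X" and "rate T X \<ge> 0"
proof -
  note fn = ent_names_finite[OF assms]
  have "enn2real (ent (names T X (m + n))) \<le> enn2real (ent (names T X m)) + enn2real (ent (names T X n))" for m n
    using ent_names_subadd[OF T X, of m n] fn[of m] fn[of n]
    by (subst enn2real_plus[symmetric]) (auto intro!: enn2real_mono)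
  from subadditive_convergent[OF this] obtain L
    where "L \<ge> 0" "(\<lambda>n. enn2real (ent (names T X n)) / real n) \<longlonglongrightarrow> L" by auto
  then show "(\<lambda>n. enn2real (ent (names T X n)) / real n) \<longlonglongrightarrow> rate T X" "rate T X \<ge> 0"
    unfolding rate_def by (auto simp: limI)
qed

text \<open>The block length \<open>N\<close> and the fixed number \<open>c\<close> of additional letters of \<open>Y\<close> leave room for using the
  past and the future of \<open>Y\<close> in predicting a block of \<open>X\<close>: the extra letters do not affect the rate.\<close>

lemma rate_le:
  fixes X :: "'a \<Rightarrow> 'b::countable" and Y :: "'a \<Rightarrow> 'c::countable"
  assumes T: "mpt T" and X: "discrete_rv X" "ent X < \<infinity>" and Y: "discrete_rv Y" "ent Y < \<infinity>"
    and N: "N > 0" and e: "e \<ge> 0"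
    and le: "\<And>n. ent (names T X (n * N)) \<le> ent (names T Y (n * N + c)) + of_nat n * ennreal (real N * e)"
  shows "rate T X \<le> rate T Y + e"
proof -
  define u where "u n = enn2real (ent (names T X n))" for n
  define v where "v n = enn2real (ent (names T Y n))" for n
  have u: "(\<lambda>n. u n / real n) \<longlonglongrightarrow> rate T X" and v: "(\<lambda>n. v n / real n) \<longlonglongrightarrow> rate T Y"
    unfolding u_def v_def by (rule rate_LIMSEQ T X Y)+
  \<comment> \<open>Both rates may be computed along the multiples of the block length.\<close>
  have mono: "strict_mono (\<lambda>n. n * N)"
    using N by (intro strict_monoI) simp
  have u': "(\<lambda>n. u (n * N) / real (n * N)) \<longlonglongrightarrow> rate T X"
    and v': "(\<lambda>n. v (n * N) / real (n * N)) \<longlonglongrightarrow> rate T Y"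
    using LIMSEQ_subseq_LIMSEQ[OF u mono] LIMSEQ_subseq_LIMSEQ[OF v mono] by (auto simp: o_def)
  have "(\<lambda>n. v c / real n) \<longlonglongrightarrow> 0"
    by (rule lim_const_over_n)
  from LIMSEQ_subseq_LIMSEQ[OF this mono] have "(\<lambda>n. v c / real (n * N)) \<longlonglongrightarrow> 0"
    by (simp add: o_def)
  from tendsto_add[OF tendsto_add[OF v' this] tendsto_const[of e]]
  have R: "(\<lambda>n. v (n * N) / real (n * N) + v c / real (n * N) + e) \<longlonglongrightarrow> rate T Y + e"
    by simp
  have "u (n * N) / real (n * N) \<le> v (n * N) / real (n * N) + v c / real (n * N) + e" if "n \<ge> 1" for n
  proof -
    note fY = ent_names_finite[OF T Y]
    have "ent (names T X (n * N)) \<le>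
        (ent (names T Y (n * N)) + ent (names T Y c)) + of_nat n * ennreal (real N * e)"
      by (rule order_trans[OF le add_right_mono]) (rule ent_names_subadd[OF T Y(1)])
    also have "\<dots> = ennreal (v (n * N) + v c + real n * (real N * e))"
    proof -
      have "ent (names T Y k) = ennreal (v k)" for k
        using fY[of k] by (simp add: v_def)
      moreover have "of_nat n * ennreal (real N * e) = ennreal (real n * (real N * e))"
        using e by (simp add: ennreal_of_nat_eq_real_of_nat ennreal_mult)
      moreover have "v k \<ge> 0" for k by (simp add: v_def)
      ultimately show ?thesis using e by (simp add: ennreal_plus[symmetric] del: ennreal_plus)
    qed
    finally have "u (n * N) \<le> v (n * N) + v c + real n * (real N * e)"
      unfolding u_def using e by (intro enn2real_leI) (auto simp: v_def)
    then have "u (n * N) / real (n * N) \<le> (v (n * N) + v c + real n * (real N * e)) / real (n * N)"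
      by (rule divide_right_mono) simp
    also have "\<dots> = v (n * N) / real (n * N) + v c / real (n * N) + e"
      using that N by (simp add: add_divide_distrib)
    finally show ?thesis .
  qed
  then show ?thesis
    by (intro LIMSEQ_le[OF u' R]) blast
qed

lemma rate_le_cond_ent:
  fixes X :: "'a \<Rightarrow> 'b::countable" and Y :: "'a \<Rightarrow> 'c::countable"
  assumes T: "mpt T" and X: "discrete_rv X" "ent X < \<infinity>" and Y: "discrete_rv Y" "ent Y < \<infinity>"
    and e: "e \<ge> 0" "cond_ent X Y \<le> ennreal e"
  shows "rate T X \<le> rate T Y + e"
proof (rule rate_le[OF T X Y zero_less_one e(1), where c = 0])
  fix n
  show "ent (names T X (n * 1)) \<le> ent (names T Y (n * 1 + 0)) + of_nat n * ennreal (real 1 * e)"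
    using order_trans[OF ent_names_le[OF T X(1) Y(1)] add_left_mono[OF mult_left_mono[OF e(2)]]]
    by simp
qed

text \<open>Identifying all values from \<open>K\<close> on loses only the information carried by \<open>{x. X x \<ge> K}\<close>, the tail
  of a convergent integral. This makes finite partitions sufficient for the supremum that defines
  the entropy of the map.\<close>

lemma cond_ent_truncate_small:
  fixes X :: "'a \<Rightarrow> nat"
  assumes X: "discrete_rv X" and fin: "ent X < \<infinity>" and e: "e > 0"
  shows "\<exists>K. cond_ent X (\<lambda>x. min (X x) K) \<le> ennreal e"
proof -
  define w where "w x = ennreal (- ln (pr X (X x)))" for x
  define u where "u K x = w x * indicator {K..} (X x)" for K :: nat and x
  have meas: "(\<lambda>x. \<psi> (X x)) \<in> borel_measurable M" for \<psi> :: "nat \<Rightarrow> ennreal"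
    by (rule discrete_rv_fun[OF X]) auto
  have "(\<lambda>K. \<integral>\<^sup>+x. u K x \<partial>M) \<longlonglongrightarrow> (\<integral>\<^sup>+x. 0 \<partial>M)"
  proof (rule nn_integral_dominated_convergence[where w = w])
    show "u K \<in> borel_measurable M" for K
      using meas[of "\<lambda>v. ennreal (- ln (pr X v)) * indicator {K..} v"] by (simp add: u_def[abs_def] w_def)
    show "w \<in> borel_measurable M"
      using meas[of "\<lambda>v. ennreal (- ln (pr X v))"] by (simp add: w_def[abs_def])
    show "(\<integral>\<^sup>+x. w x \<partial>M) < \<infinity>"
      using fin by (simp add: w_def ent_def)
    show "AE x in M. u K x \<le> w x" for K
      by (auto simp: u_def split: split_indicator)
    show "AE x in M. (\<lambda>K. u K x) \<longlonglongrightarrow> 0"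
    proof (rule AE_I2)
      fix x
      have "eventually (\<lambda>K. u K x = 0) sequentially"
        using eventually_gt_at_top[of "X x"] by eventually_elim (auto simp: u_def)
      then show "(\<lambda>K. u K x) \<longlonglongrightarrow> 0" by (rule tendsto_eventually)
    qed
  qed simp
  then have "eventually (\<lambda>K. (\<integral>\<^sup>+x. u K x \<partial>M) < ennreal e) sequentially"
    using e by (intro order_tendstoD) auto
  then obtain K where K: "(\<integral>\<^sup>+x. u K x \<partial>M) < ennreal e"
    by (auto simp: eventually_sequentially)
  let ?Y = "\<lambda>x. min (X x) K"
  have Y: "discrete_rv ?Y" by (rule discrete_rv_fun[OF X]) simp
  have eq: "pr (\<lambda>x. (X x, ?Y x)) (X x, ?Y x) = pr X (X x)" for x
    unfolding pr_def by (rule arg_cong[where f = prob]) auto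
  have "cond_ent X ?Y \<le> (\<integral>\<^sup>+x. u K x \<partial>M)"
    unfolding cond_ent_def eq
  proof (rule nn_integral_mono_AE)
    show "AE x in M. ennreal (ln (pr ?Y (?Y x) / pr X (X x))) \<le> u K x"
      using AE_pr_pos[OF X]
    proof eventually_elim
      case (elim x)
      show ?case
      proof (cases "X x < K")
        case True
        have "pr ?Y (?Y x) = pr X (X x)"
          unfolding pr_def using True by (intro arg_cong[where f = prob]) auto
        with elim show ?thesis by simp
      next
        case False
        have "ln (pr ?Y (?Y x) / pr X (X x)) \<le> ln (1 / pr X (X x))"
        proof (cases "pr ?Y (?Y x) > 0")
          case True
          then show ?thesis using elim by (subst ln_le_cancel_iff) (auto simp: divide_right_mono)
        next
          case False
          then have "pr ?Y (?Y x) = 0" by (metis pr_nonneg less_eq_real_def)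
          then show ?thesis using elim by simp
        qed
        then show ?thesis
          using False elim by (auto simp: u_def w_def ln_div intro!: ennreal_leI)
      qed
    qed
  qed
  with K show ?thesis by (meson less_imp_le order_trans)
qed

end

section \<open>Partitions and their labels\<close>

lemma atom_eqI:
  assumes "partition_on S \<A>" "A \<in> \<A>" "x \<in> A" shows "atom \<A> x = A"
  unfolding atom_def
proof (rule the_equality)
  show "B = A" if "B \<in> \<A> \<and> x \<in> B" for B
    using that assms partition_onD2[OF assms(1)] by (auto dest: disjointD)
qed (use assms in auto)

lemma atom_in: "partition_on S \<A> \<Longrightarrow> x \<in> S \<Longrightarrow> atom \<A> x \<in> \<A>"
  and in_atom: "partition_on S \<A> \<Longrightarrow> x \<in> S \<Longrightarrow> x \<in> atom \<A> x"
  by (metis UnionE atom_eqI partition_onD1)+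

lemma partition_on_dynamical_join:
  assumes \<A>: "partition_on S \<A>" and f: "\<And>x. x \<in> S \<Longrightarrow> f x \<in> S"
  shows "partition_on S (dynamical_join S f \<A> n)"
    and "x \<in> S \<Longrightarrow> atom (dynamical_join S f \<A> n) x = {y \<in> S. \<forall>i<n. (f ^^ i) y \<in> atom \<A> ((f ^^ i) x)}"
proof -
  have fi: "(f ^^ i) x \<in> S" if "x \<in> S" for i x
    using that f by (induction i) auto
  define J where "J x = {y \<in> S. \<forall>i<n. (f ^^ i) y \<in> atom \<A> ((f ^^ i) x)}" for x
  have J_in: "x \<in> J x" if "x \<in> S" for x
    using that fi in_atom[OF \<A>] by (auto simp: J_def)
  have join: "dynamical_join S f \<A> n = J ` S"
  proof (intro set_eqI iffI)
    fix A assume "A \<in> dynamical_join S f \<A> n"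
    then obtain a where a: "a \<in> {..<n} \<rightarrow>\<^sub>E \<A>" "A = {x \<in> S. \<forall>i<n. (f ^^ i) x \<in> a i}" "A \<noteq> {}"
      by (auto simp: dynamical_join_def)
    then obtain x where x: "x \<in> A" by blast
    have "a i = atom \<A> ((f ^^ i) x)" if "i < n" for i
      using a x that by (intro atom_eqI[OF \<A>, symmetric]) auto
    then have "A = J x" using a by (auto simp: J_def)
    then show "A \<in> J ` S" using x a by auto
  next
    fix A assume "A \<in> J ` S"
    then obtain x where x: "x \<in> S" "A = J x" by auto
    have "A = (\<lambda>a. {x \<in> S. \<forall>i<n. (f ^^ i) x \<in> a i}) (restrict (\<lambda>i. atom \<A> ((f ^^ i) x)) {..<n})"
      using x by (auto simp: J_def)
    moreover have "restrict (\<lambda>i. atom \<A> ((f ^^ i) x)) {..<n} \<in> {..<n} \<rightarrow>\<^sub>E \<A>"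
      using x fi atom_in[OF \<A>] by auto
    ultimately show "A \<in> dynamical_join S f \<A> n"
      using J_in x unfolding dynamical_join_def by blast
  qed
  have J_eq: "J x = J y" if "x \<in> S" "y \<in> S" "z \<in> J x" "z \<in> J y" for x y z
  proof -
    have "atom \<A> ((f ^^ i) x) = atom \<A> ((f ^^ i) y)" if "i < n" for i
      using that \<open>z \<in> J x\<close> \<open>z \<in> J y\<close> \<open>x \<in> S\<close> \<open>y \<in> S\<close> atom_eqI[OF \<A> atom_in[OF \<A> fi]]
      unfolding J_def by (metis (mono_tags, lifting) mem_Collect_eq)
    then show ?thesis by (auto simp: J_def)
  qed
  show part: "partition_on S (dynamical_join S f \<A> n)"
    unfolding join
  proof (rule partition_onI)
    show "\<Union>(J ` S) = S" using J_in by (auto simp: J_def)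
    show "disjnt p q" if "p \<in> J ` S" "q \<in> J ` S" "p \<noteq> q" for p q
      using that J_eq unfolding disjnt_def by blast
    show "{} \<notin> J ` S" using J_in by auto
  qed
  show "atom (dynamical_join S f \<A> n) x = {y \<in> S. \<forall>i<n. (f ^^ i) y \<in> atom \<A> ((f ^^ i) x)}" if "x \<in> S"
    using atom_eqI[OF part, of "J x" x] that J_in by (auto simp: J_def join)
qed

lemma infsum_eq_nn_integral_count_space:
  fixes \<phi> :: "'b::countable \<Rightarrow> ennreal"
  shows "infsum \<phi> UNIV = (\<integral>\<^sup>+v. \<phi> v \<partial>count_space UNIV)"
proof (rule antisym)
  have fin: "(\<Sum>v\<in>F. \<phi> v) = (\<integral>\<^sup>+v. \<phi> v * indicator F v \<partial>count_space UNIV)" if "finite F" for F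
    using that by (subst nn_integral_count_space'[of F]) auto
  have sup: "infsum \<phi> UNIV = (SUP F\<in>{F. finite F \<and> F \<subseteq> UNIV}. sum \<phi> F)"
    by (rule nonneg_infsum_complete) simp
  show "infsum \<phi> UNIV \<le> (\<integral>\<^sup>+v. \<phi> v \<partial>count_space UNIV)"
    unfolding sup by (intro SUP_least) (auto simp: fin intro!: nn_integral_mono split: split_indicator)
  define F where "F n = {v::'b. to_nat v < n}" for n
  have finF: "finite (F n)" for n
  proof -
    have "F n \<subseteq> from_nat ` {..<n}"
      unfolding F_def by (metis (mono_tags, lifting) from_nat_to_nat imageI lessThan_iff mem_Collect_eq subsetI)
    then show ?thesis by (rule finite_subset) simp
  qed
  have "(SUP n. \<phi> v * indicator (F n) v) = \<phi> v" for v
  proof (rule antisym)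
    show "(SUP n. \<phi> v * indicator (F n) v) \<le> \<phi> v"
      by (intro SUP_least) (auto split: split_indicator)
    show "\<phi> v \<le> (SUP n. \<phi> v * indicator (F n) v)"
      by (rule SUP_upper2[of "Suc (to_nat v)"]) (auto simp: F_def)
  qed
  then have "(\<integral>\<^sup>+v. \<phi> v \<partial>count_space UNIV) = (\<integral>\<^sup>+v. (SUP n. \<phi> v * indicator (F n) v) \<partial>count_space UNIV)"
    by simp
  also have "\<dots> = (SUP n. \<integral>\<^sup>+v. \<phi> v * indicator (F n) v \<partial>count_space UNIV)"
    by (intro nn_integral_monotone_convergence_SUP)
      (auto simp: incseq_def le_fun_def F_def split: split_indicator)
  also have "\<dots> = (SUP n. sum \<phi> (F n))"
    using fin[OF finF] by simp
  also have "\<dots> \<le> infsum \<phi> UNIV"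
    unfolding sup using finF by (intro SUP_mono) auto
  finally show "(\<integral>\<^sup>+v. \<phi> v \<partial>count_space UNIV) \<le> infsum \<phi> UNIV" .
qed

context prob_space
begin

text \<open>It suffices that the level sets of \<open>X\<close> are the elements of the partition almost everywhere: the
  level sets of positive measure are then exactly the elements of positive measure, and all others
  contribute nothing to the sum. So a measurable partition, even an uncountable one, may be replaced
  by a variable with countably many values.\<close>

lemma partition_entropy_eq_ent:
  fixes X :: "'a \<Rightarrow> 'b::countable"
  assumes \<A>: "partition_on (space M) \<A>" and X: "discrete_rv X"
    and lev: "AE x in M. {y \<in> space M. X y = X x} = atom \<A> x"
  shows "partition_entropy M \<A> = ent X"
proof -
  define lv where "lv v = {y \<in> space M. X y = v}" for v
  have pr_lv: "pr X v = prob (lv v)" for v by (simp add: pr_def lv_def)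
  have good: "\<exists>x\<in>B. {y \<in> space M. X y = X x} = atom \<A> x" if "B \<in> events" "0 < prob B" for B
  proof (rule ccontr)
    assume "\<not> ?thesis"
    then have "AE x in M. x \<notin> B"
      using lev by (auto elim!: eventually_mono)
    then have "prob B = 0"
      using \<open>B \<in> events\<close> by (simp add: prob_eq_0)
    with that show False by simp
  qed
  have "AE x in M. 0 < measure M (atom \<A> x)"
    using lev AE_pr_pos[OF X] by eventually_elim (auto simp: pr_def)
  then have "partition_entropy M \<A> = (\<Sum>\<^sub>\<infinity>A\<in>\<A>. ennreal (- (measure M A * ln (measure M A))))"
    by (simp add: partition_entropy_def)
  also have "\<dots> = (\<Sum>\<^sub>\<infinity>A\<in>lv ` {v. 0 < pr X v}. ennreal (- (measure M A * ln (measure M A))))"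
  proof (rule infsum_cong_neutral)
    fix A assume "A \<in> lv ` {v. 0 < pr X v} - \<A>"
    then obtain v where v: "A = lv v" "0 < pr X v" "A \<notin> \<A>" by auto
    from good[of A] v discrete_rv_level[OF X, of v] obtain x where x: "x \<in> A" "lv (X x) = atom \<A> x"
      by (auto simp: pr_lv lv_def)
    with v have "A = atom \<A> x" "x \<in> space M" by (auto simp: lv_def)
    with atom_in[OF \<A>, of x] v have False by metis
    then show "ennreal (- (measure M A * ln (measure M A))) = 0" ..
  next
    fix A assume A: "A \<in> \<A> - lv ` {v. 0 < pr X v}"
    have "measure M A = 0"
    proof (rule ccontr)
      assume "measure M A \<noteq> 0"
      then have pos: "0 < prob A" by (simp add: zero_less_measure_iff)
      then have ev: "A \<in> events" by (metis measure_notin_sets less_irrefl)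
      from good[OF ev pos] obtain x where x: "x \<in> A" "lv (X x) = atom \<A> x" by (auto simp: lv_def)
      then have "lv (X x) = A" using A by (simp add: atom_eqI[OF \<A>])
      then show False using A pos pr_lv by auto
    qed
    then show "ennreal (- (measure M A * ln (measure M A))) = 0" by simp
  qed auto
  also have "\<dots> = (\<Sum>\<^sub>\<infinity>v\<in>{v. 0 < pr X v}. ennreal (- (pr X v * ln (pr X v))))"
  proof (subst infsum_reindex)
    show "inj_on lv {v. 0 < pr X v}"
    proof (rule inj_onI)
      fix v w assume "v \<in> {v. 0 < pr X v}" "lv v = lv w"
      then have "lv v \<noteq> {}" by (auto simp: pr_lv)
      with \<open>lv v = lv w\<close> show "v = w" by (auto simp: lv_def)
    qed
  qed (simp add: o_def pr_lv)
  also have "\<dots> = (\<Sum>\<^sub>\<infinity>v. ennreal (- (pr X v * ln (pr X v))))"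
    by (rule infsum_cong_neutral) (auto, metis less_eq_real_def mult_eq_0_iff pr_nonneg ennreal_0 neg_0_equal_iff_equal)
  also have "\<dots> = (\<integral>\<^sup>+v. ennreal (- ln (pr X v)) * ennreal (pr X v) \<partial>count_space UNIV)"
    unfolding infsum_eq_nn_integral_count_space
    by (intro nn_integral_cong, subst ennreal_mult''[symmetric]) (simp_all add: mult.commute)
  also have "\<dots> = ent X"
    unfolding ent_def by (rule nn_integral_discrete_rv[OF X, symmetric])
  finally show ?thesis .
qed

text \<open>The measures of disjoint sets are summable, and a summable family has countable support.\<close>

lemma countable_positive_atoms:
  assumes \<A>: "partition_on (space M) \<A>"
  shows "countable {A \<in> \<A>. 0 < measure M A}"
proof -
  let ?P = "{A \<in> \<A>. 0 < measure M A}"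
  have ev: "A \<in> events" if "A \<in> ?P" for A
    using that by (metis (mono_tags, lifting) measure_notin_sets less_irrefl mem_Collect_eq)
  have "measure M summable_on ?P"
  proof (rule nonneg_bdd_above_summable_on)
    show "bdd_above (sum (measure M) ` {F. F \<subseteq> ?P \<and> finite F})"
    proof (rule bdd_aboveI2)
      fix F assume F: "F \<in> {F. F \<subseteq> ?P \<and> finite F}"
      have "sum (measure M) F = prob (\<Union>A\<in>F. A)"
        using F ev partition_onD2[OF \<A>]
        by (intro finite_measure_finite_Union[symmetric]) (auto simp: disjoint_family_on_def disjoint_def)
      also have "\<dots> \<le> 1" by simp
      finally show "sum (measure M) F \<le> 1" .
    qed
  qed auto
  then have "countable {A \<in> ?P. measure M A \<noteq> 0}"
    by (rule summable_countable_real)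
  then show ?thesis by (rule countable_subset[rotated]) auto
qed

text \<open>The label 0 collects all elements of measure zero, whose union is a null set here.\<close>

lemma partition_label:
  assumes \<A>: "partition_on (space M) \<A>" "\<A> \<subseteq> events" and pos: "AE x in M. 0 < measure M (atom \<A> x)"
  obtains q :: "'a \<Rightarrow> nat" where "discrete_rv q" "AE x in M. q x \<noteq> 0"
    "\<And>x. x \<in> space M \<Longrightarrow> q x \<noteq> 0 \<Longrightarrow> {y \<in> space M. q y = q x} = atom \<A> x"
    "finite \<A> \<Longrightarrow> finite (range q)"
proof -
  define \<P> where "\<P> = {A \<in> \<A>. 0 < measure M A}"
  define q where "q x = (if x \<in> space M \<and> atom \<A> x \<in> \<P> then Suc (to_nat_on \<P> (atom \<A> x)) else 0)" for x
  have cnt: "countable \<P>" unfolding \<P>_def by (rule countable_positive_atoms[OF \<A>(1)])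
  have lev: "{y \<in> space M. q y = q x} = atom \<A> x" if x: "x \<in> space M" "q x \<noteq> 0" for x
  proof (intro set_eqI iffI)
    have P: "atom \<A> x \<in> \<P>" using x by (auto simp: q_def split: if_splits)
    fix y
    { assume y: "y \<in> {y \<in> space M. q y = q x}"
      then have "atom \<A> y = atom \<A> x"
        using x cnt P by (auto simp: q_def split: if_splits)
      with y in_atom[OF \<A>(1), of y] show "y \<in> atom \<A> x" by auto }
    { assume y: "y \<in> atom \<A> x"
      then have "atom \<A> y = atom \<A> x"
        by (rule atom_eqI[OF \<A>(1) atom_in[OF \<A>(1) x(1)]])
      moreover have "y \<in> space M"
        using y atom_in[OF \<A>(1) x(1)] partition_onD1[OF \<A>(1)] by auto
      ultimately show "y \<in> {y \<in> space M. q y = q x}"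
        using x by (auto simp: q_def) }
  qed
  have ev: "q -` {v} \<inter> space M \<in> events" if "v \<noteq> 0" for v
  proof (cases "\<exists>x\<in>space M. q x = v")
    case True
    then obtain x where x: "x \<in> space M" "q x = v" by auto
    then have "q -` {v} \<inter> space M = atom \<A> x" using lev[of x] that by auto
    then show ?thesis using atom_in[OF \<A>(1) x(1)] \<A>(2) by auto
  next
    case False
    then have "q -` {v} \<inter> space M = {}" by auto
    then show ?thesis by simp
  qed
  have "q -` {0} \<inter> space M = space M - (\<Union>v\<in>-{0}. q -` {v} \<inter> space M)"
    by auto
  also have "\<dots> \<in> events" using ev by (intro sets.Diff sets.countable_UN') auto
  finally have "q -` {v} \<inter> space M \<in> events" for v
    using ev by (cases "v = 0") auto
  then have "discrete_rv q"
    by (subst measurable_count_space_eq_countable) auto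
  moreover have "AE x in M. q x \<noteq> 0"
    using pos AE_space by eventually_elim (auto simp: q_def \<P>_def atom_in[OF \<A>(1)])
  moreover have "finite (range q)" if "finite \<A>"
  proof -
    have "range q \<subseteq> insert 0 ((\<lambda>A. Suc (to_nat_on \<P> A)) ` \<A>)"
      by (auto simp: q_def \<P>_def)
    then show ?thesis by (rule finite_subset) (simp add: that)
  qed
  ultimately show ?thesis using that lev by blast
qed

lemma entropy_wrt_eq_rate:
  fixes q :: "'a \<Rightarrow> 'b::countable"
  assumes \<A>: "partition_on (space M) \<A>" and T: "mpt T"
    and q: "discrete_rv q" "ent q < \<infinity>"
    and lev: "AE x in M. {y \<in> space M. q y = q x} = atom \<A> x"
  shows "entropy_wrt M T \<A> = ennreal (rate T q)"
proof -
  have T_space: "T x \<in> space M" if "x \<in> space M" for x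
    using mpt_measurable[OF T] that by (rule measurable_space)
  have Ti: "(T ^^ i) x \<in> space M" if "x \<in> space M" for i x
    using that T_space by (induction i) auto
  have pe: "partition_entropy M (dynamical_join (space M) T \<A> n) = ent (names T q n)" for n
  proof (rule partition_entropy_eq_ent[OF _ discrete_rv_names[OF T q(1)]])
    show "partition_on (space M) (dynamical_join (space M) T \<A> n)"
      by (rule partition_on_dynamical_join[OF \<A> T_space])
    have "AE x in M. \<forall>i. {y \<in> space M. q y = q ((T ^^ i) x)} = atom \<A> ((T ^^ i) x)"
      using mpt_AE[OF mpt_funpow[OF T] lev] by (simp add: AE_all_countable)
    then show "AE x in M. {y \<in> space M. names T q n y = names T q n x} =
        atom (dynamical_join (space M) T \<A> n) x"
      using AE_space
    proof eventually_elim
      case (elim x)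
      have "(T ^^ i) y \<in> atom \<A> ((T ^^ i) x) \<longleftrightarrow> q ((T ^^ i) y) = q ((T ^^ i) x)"
        if "y \<in> space M" for y i
        using elim(1) Ti[OF that, of i] by blast
      moreover have "atom (dynamical_join (space M) T \<A> n) x =
          {y \<in> space M. \<forall>i<n. (T ^^ i) y \<in> atom \<A> ((T ^^ i) x)}"
        by (rule partition_on_dynamical_join(2)[OF \<A>]) (auto intro: T_space elim)
      ultimately show ?case
        by (auto simp: names_eq_iff)
    qed
  qed
  have fin: "ent (names T q n) < \<infinity>" for n
    by (rule ent_names_finite[OF T q])
  have "(\<lambda>n. ennreal (enn2real (ent (names T q n)) / real n)) \<longlonglongrightarrow> ennreal (rate T q)"
    by (intro tendsto_ennrealI rate_LIMSEQ T q)
  moreover have "eventually (\<lambda>n. ennreal (enn2real (ent (names T q n)) / real n) =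
      partition_entropy M (dynamical_join (space M) T \<A> n) / of_nat n) sequentially"
    using eventually_gt_at_top[of 0]
  proof eventually_elim
    case (elim n)
    have "ennreal (enn2real (ent (names T q n)) / real n) = ennreal (enn2real (ent (names T q n))) / ennreal (real n)"
      using elim by (intro divide_ennreal[symmetric]) auto
    then show ?case using fin[of n] by (simp add: pe ennreal_of_nat_eq_real_of_nat)
  qed
  ultimately have "(\<lambda>n. partition_entropy M (dynamical_join (space M) T \<A> n) / of_nat n)
      \<longlonglongrightarrow> ennreal (rate T q)"
    by (rule Lim_transform_eventually)
  then show ?thesis unfolding entropy_wrt_def by (rule limI)
qed

end

section \<open>Closed sets on which discrete random variables are continuous\<close>

locale compact_prob_space = prob_space M for M :: "'a::metric_space measure" +
  assumes compact_space: "compact (space M)"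
    and sets_eq: "events = sets (restrict_space borel (space M))"
begin

lemma borel_Int_events: "B \<in> sets borel \<Longrightarrow> B \<inter> space M \<in> events"
  unfolding sets_eq sets_restrict_space by auto

lemma closed_events: "closed L \<Longrightarrow> L \<subseteq> space M \<Longrightarrow> L \<in> events"
  using borel_Int_events[of L] by (auto simp: Int_absorb2)

text \<open>Tameness says that the indicator function of \<open>A\<close> becomes continuous after removing a set of small
  measure: \<open>A\<close> is clopen relative to \<open>L\<close>.\<close>

definition tame :: "'a set \<Rightarrow> bool" where
  "tame A \<longleftrightarrow> (\<forall>e>0. \<exists>L. closed L \<and> L \<subseteq> space M \<and> prob (space M - L) < e \<and>
     closed (L \<inter> A) \<and> closed (L - A))"

text \<open>One set \<open>L\<close> serves a whole sequence, as tameness relative to \<open>L\<close> passes to closed subsets and the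
  losses can be chosen to form a geometric series.\<close>

lemma tame_sequence:
  assumes A: "\<And>i::nat. tame (A i)" and e: "e > 0"
  obtains L where "closed L" "L \<subseteq> space M" "prob (space M - L) < e"
    "\<And>i. closed (L \<inter> A i)" "\<And>i. closed (L - A i)"
proof -
  define d where "d i = e / 2 * (1/2) ^ Suc i" for i
  have "d i > 0" for i using e by (simp add: d_def)
  with A have "\<exists>L. closed L \<and> L \<subseteq> space M \<and> prob (space M - L) < d i \<and>
     closed (L \<inter> A i) \<and> closed (L - A i)" for i
    unfolding tame_def by blast
  then obtain L where L: "\<And>i. closed (L i)" "\<And>i. L i \<subseteq> space M" "\<And>i. prob (space M - L i) < d i"
     "\<And>i. closed (L i \<inter> A i)" "\<And>i. closed (L i - A i)"
    by metis
  have sums: "d sums (e / 2 * 1)"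
    unfolding d_def by (intro sums_mult power_half_series)
  have summ: "summable (\<lambda>i. prob (space M - L i))"
    by (rule summable_comparison_test'[OF sums_summable[OF sums], of 0]) (simp add: L(3) less_imp_le)
  have "space M - \<Inter>(range L) = (\<Union>i. space M - L i)" by auto
  also have "prob \<dots> \<le> (\<Sum>i. prob (space M - L i))"
  proof (rule finite_measure_subadditive_countably)
    show "range (\<lambda>i. space M - L i) \<subseteq> events" using closed_events[OF L(1,2)] by blast
  qed (rule summ)
  also have "\<dots> \<le> (\<Sum>i. d i)"
    using L(3) sums by (intro suminf_le[OF _ summ]) (auto simp: sums_iff less_imp_le)
  also have "\<dots> < e" using sums e by (simp add: sums_iff)
  finally have "prob (space M - \<Inter>(range L)) < e" .
  moreover have "closed (\<Inter>(range L) \<inter> A i)" for i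
  proof -
    have "\<Inter>(range L) \<inter> A i = \<Inter>(range L) \<inter> (L i \<inter> A i)" by auto
    also have "closed \<dots>" by (intro closed_Int closed_INT ballI L)
    finally show ?thesis .
  qed
  moreover have "closed (\<Inter>(range L) - A i)" for i
  proof -
    have "\<Inter>(range L) - A i = \<Inter>(range L) \<inter> (L i - A i)" by auto
    also have "closed \<dots>" by (intro closed_Int closed_INT ballI L)
    finally show ?thesis .
  qed
  moreover have "closed (\<Inter>(range L))" using L by auto
  moreover have "\<Inter>(range L) \<subseteq> space M" using L(2)[of 0] by blast
  ultimately show ?thesis using that by blast
qed

text \<open>For small \<open>\<epsilon>\<close> one removes the points outside the closed set \<open>A\<close> with distance less than \<open>\<epsilon>\<close> from
  it; what remains of the complement is closed.\<close>

lemma tame_closed: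
  assumes C: "closed C" shows "tame (C \<inter> space M)"
proof (cases "C \<inter> space M = {}")
  case True
  have "closed (space M)" by (rule compact_imp_closed[OF compact_space])
  with True show ?thesis by (auto simp: tame_def intro!: exI[of _ "space M"])
next
  case False
  define A where "A = C \<inter> space M"
  have cl: "closed A" unfolding A_def using C compact_space compact_imp_closed by auto
  define K where "K n = {x \<in> space M. 1 / real (Suc n) \<le> infdist x A}" for n
  have clK: "closed (K n)" for n
  proof -
    have "K n = space M \<inter> {x. 1 / real (Suc n) \<le> infdist x A}" by (auto simp: K_def)
    also have "closed \<dots>"
      using compact_space compact_imp_closed
      by (intro closed_Int closed_Collect_le continuous_intros) auto
    finally show ?thesis .
  qed
  have lim: "(\<lambda>n. prob (space M - (A \<union> K n))) \<longlonglongrightarrow> prob (\<Inter>n. space M - (A \<union> K n))"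
  proof (rule finite_Lim_measure_decseq)
    show "range (\<lambda>n. space M - (A \<union> K n)) \<subseteq> events"
    proof -
      have "A \<in> events" "K n \<in> events" for n
        using closed_events[OF cl] closed_events[OF clK[of n]] by (auto simp: A_def K_def)
      then show ?thesis by auto
    qed
    have "K m \<subseteq> K n" if "m \<le> n" for m n
    proof -
      have "1 / real (Suc n) \<le> 1 / real (Suc m)" using that by (simp add: field_simps)
      then show ?thesis by (auto simp: K_def)
    qed
    then show "decseq (\<lambda>n. space M - (A \<union> K n))" by (auto simp: decseq_def) 
  qed
  have "(\<Inter>n. space M - (A \<union> K n)) = {}"
  proof (rule ccontr)
    assume "\<not> ?thesis"
    then obtain x where x: "x \<in> space M" "x \<notin> A" "\<And>n. x \<notin> K n" by auto
    have "infdist x A > 0" using cl False x by (intro infdist_pos_not_in_closed) (auto simp: A_def)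
    then obtain n where "inverse (real (Suc n)) < infdist x A" using reals_Archimedean by blast
    with x(1) x(3)[of n] show False by (auto simp: K_def inverse_eq_divide)
  qed
  with lim have lim: "(\<lambda>n. prob (space M - (A \<union> K n))) \<longlonglongrightarrow> 0"
    by (simp only: measure_empty)
  show ?thesis unfolding tame_def A_def[symmetric]
  proof (intro allI impI)
    fix e :: real assume "e > 0"
    then have "eventually (\<lambda>n. prob (space M - (A \<union> K n)) < e) sequentially"
      using lim by (intro order_tendstoD)
    then obtain n where n: "prob (space M - (A \<union> K n)) < e" by (auto simp: eventually_sequentially)
    have "A \<inter> K n = {}" by (auto simp: K_def)
    then have "(A \<union> K n) \<inter> A = A" "(A \<union> K n) - A = K n" by auto
    with n cl clK show "\<exists>L. closed L \<and> L \<subseteq> space M \<and> prob (space M - L) < e \<and>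
        closed (L \<inter> A) \<and> closed (L - A)"
      by (intro exI[of _ "A \<union> K n"]) (auto simp: A_def K_def)
  qed
qed

text \<open>Relative to the set \<open>L\<close> for the sequence the union is open; it becomes closed as well
  if it is replaced by a finite union, at the price of removing a set of small measure.\<close>

lemma tame_Union:
  assumes A: "\<And>i::nat. tame (A i)" and ev: "\<And>i. A i \<in> events"
  shows "tame (\<Union>i. A i)"
  unfolding tame_def
proof (intro allI impI)
  fix e :: real assume e: "e > 0"
  then have e2: "e / 2 > 0" by simp
  obtain L where L: "closed L" "L \<subseteq> space M" "prob (space M - L) < e / 2"
    "\<And>i. closed (L \<inter> A i)" "\<And>i. closed (L - A i)"
    by (rule tame_sequence[OF A e2]) (rule that)
  define B where "B = (\<Union>i. A i)"
  define D where "D m = (\<Union>i\<le>m. A i)" for m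
  have "(\<lambda>m. prob (B - D m)) \<longlonglongrightarrow> prob (\<Inter>m. B - D m)"
  proof (rule finite_Lim_measure_decseq)
    show "range (\<lambda>m. B - D m) \<subseteq> events" using ev by (auto simp: B_def D_def)
    show "decseq (\<lambda>m. B - D m)" by (force simp: decseq_def D_def)
  qed
  moreover have "(\<Inter>m. B - D m) = {}" by (auto simp: B_def D_def)
  ultimately have "(\<lambda>m. prob (B - D m)) \<longlonglongrightarrow> 0" by (simp only: measure_empty)
  then have "eventually (\<lambda>m. prob (B - D m) < e / 2) sequentially"
    using e2 by (rule order_tendstoD)
  then obtain m where m: "prob (B - D m) < e / 2" by (auto simp: eventually_sequentially)
  define L' where "L' = (L - B) \<union> (L \<inter> D m)"
  have "closed (L - B)"
  proof -
    have "L - B = (\<Inter>i. L - A i)" by (auto simp: B_def)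
    also have "closed \<dots>" by (intro closed_INT ballI L)
    finally show ?thesis .
  qed
  moreover have "closed (L \<inter> D m)"
  proof -
    have "L \<inter> D m = (\<Union>i\<le>m. L \<inter> A i)" by (auto simp: D_def)
    also have "closed \<dots>" by (intro closed_UN ballI L) simp
    finally show ?thesis .
  qed
  moreover have "L' \<inter> B = L \<inter> D m" "L' - B = L - B" by (auto simp: L'_def D_def B_def)
  moreover have "prob (space M - L') < e"
  proof -
    have meas: "space M - L \<in> events" "B - D m \<in> events"
      using L ev by (auto intro: closed_events simp: B_def D_def)
    have "space M - L' \<subseteq> (space M - L) \<union> (B - D m)" by (auto simp: L'_def)
    then have "prob (space M - L') \<le> prob ((space M - L) \<union> (B - D m))"
      using meas by (intro finite_measure_mono) auto
    also have "\<dots> \<le> prob (space M - L) + prob (B - D m)"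
      using meas by (intro measure_Un_le)
    finally show ?thesis using m L by linarith
  qed
  moreover have "L' \<subseteq> space M" using L by (auto simp: L'_def)
  ultimately show "\<exists>L. closed L \<and> L \<subseteq> space M \<and> prob (space M - L) < e \<and>
      closed (L \<inter> (\<Union>i. A i)) \<and> closed (L - (\<Union>i. A i))"
    unfolding B_def[symmetric] by (intro exI[of _ L']) (auto simp: L'_def)
qed

lemma tame_events:
  assumes "A \<in> events" shows "tame A"
proof -
  have "tame (B \<inter> space M)" if "B \<in> sigma_sets UNIV (Collect closed)" for B
    using that
  proof (induction rule: sigma_sets.induct)
    case (Basic a)
    then show ?case using tame_closed by simp
  next
    case Empty
    show ?case using tame_closed[of "{}"] by simp
  next
    case (Compl a)
    show ?case unfolding tame_def
    proof (intro allI impI)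
      fix e :: real assume "e > 0"
      with Compl obtain L where L: "closed L" "L \<subseteq> space M" "prob (space M - L) < e"
        "closed (L \<inter> (a \<inter> space M))" "closed (L - (a \<inter> space M))"
        unfolding tame_def by blast
      moreover have "L \<inter> ((UNIV - a) \<inter> space M) = L - (a \<inter> space M)"
        "L - ((UNIV - a) \<inter> space M) = L \<inter> (a \<inter> space M)" using L by auto
      ultimately show "\<exists>L. closed L \<and> L \<subseteq> space M \<and> prob (space M - L) < e \<and>
          closed (L \<inter> ((UNIV - a) \<inter> space M)) \<and> closed (L - ((UNIV - a) \<inter> space M))"
        by metis
    qed
  next
    case (Union a)
    have "a i \<inter> space M \<in> events" for i
      using Union(1) by (intro borel_Int_events) (simp add: borel_eq_closed)
    from tame_Union[OF Union(2) this] show ?case by (simp add: UN_extend_simps del: UN_simps)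
  qed
  moreover from assms obtain B where "B \<in> sets borel" "A = B \<inter> space M"
    unfolding sets_eq sets_restrict_space by auto
  ultimately show ?thesis by (simp add: borel_eq_closed)
qed

text \<open>Lusin's theorem for countably many discrete variables at once: all their restrictions to \<open>L\<close> are
  continuous.\<close>

lemma lusin:
  fixes X :: "'i::countable \<Rightarrow> 'a \<Rightarrow> 'b::countable"
  assumes X: "\<And>i. discrete_rv (X i)" and e: "e > 0"
  obtains L where "closed L" "L \<subseteq> space M" "prob (space M - L) < e"
    "\<And>i v. closed {x \<in> L. X i x = v}"
proof -
  define A where "A n = (case from_nat n of (i, v) \<Rightarrow> {x \<in> space M. X i x = v})" for n
  have A: "tame (A n)" for n
    using discrete_rv_level[OF X] by (auto simp: A_def intro: tame_events split: prod.split)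
  obtain L where L: "closed L" "L \<subseteq> space M" "prob (space M - L) < e"
    "\<And>i. closed (L \<inter> A i)"
    by (rule tame_sequence[OF A e]) (rule that)
  have "closed {x \<in> L. X i x = v}" for i v
  proof -
    have "{x \<in> L. X i x = v} = L \<inter> A (to_nat (i, v))" using L(2) by (auto simp: A_def)
    then show ?thesis using L by simp
  qed
  with L that show ?thesis by blast
qed

end

section \<open>Counting names\<close>

text \<open>The words \<open>w\<close> that agree with \<open>v\<close> except for letters in \<open>B\<close> have total weight at most
  \<open>(1 + card B * s)\<^sup>n\<close> if every letter in \<open>B\<close> has weight \<open>s\<close>: the generating function of the
  number of exceptional letters factorises over the positions.\<close>

lemma sum_weights_list_all2:
  fixes s :: real and B :: "'b set"
  assumes B: "finite B" and s: "0 \<le> s" "s \<le> 1"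
  defines "W \<equiv> \<lambda>v. {w. list_all2 (\<lambda>a b. a \<in> B \<or> a = b) w v}"
  shows "finite (W v)" "(\<Sum>w\<in>W v. s ^ length (filter (\<lambda>a. a \<in> B) w)) \<le> (1 + card B * s) ^ length v"
proof (induction v)
  case Nil
  have "W [] = {[]}" by (auto simp: W_def)
  then show "finite (W [])" "(\<Sum>w\<in>W []. s ^ length (filter (\<lambda>a. a \<in> B) w)) \<le> (1 + card B * s) ^ length []"
    by simp_all
next
  case (Cons b v)
  have eq: "W (b # v) = (\<lambda>(a, w). a # w) ` (insert b B \<times> W v)"
    by (auto simp: W_def list_all2_Cons2)
  have inj: "inj_on (\<lambda>(a, w). a # w) (insert b B \<times> W v)" by (auto simp: inj_on_def)
  show "finite (W (b # v))" unfolding eq using B Cons by simp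
  have 1: "(\<Sum>a\<in>insert b B. if a \<in> B then s else 1) \<le> 1 + card B * s"
    using B s by (cases "b \<in> B") (simp_all add: insert_absorb)
  have "(\<Sum>w\<in>W (b # v). s ^ length (filter (\<lambda>a. a \<in> B) w)) =
      (\<Sum>(a, w)\<in>insert b B \<times> W v. (if a \<in> B then s else 1) * s ^ length (filter (\<lambda>a. a \<in> B) w))"
    unfolding eq by (subst sum.reindex[OF inj]) (auto simp: o_def intro!: sum.cong)
  also have "\<dots> = (\<Sum>a\<in>insert b B. if a \<in> B then s else 1) * (\<Sum>w\<in>W v. s ^ length (filter (\<lambda>a. a \<in> B) w))"
    by (simp add: sum.cartesian_product[symmetric] sum_product)
  also have "\<dots> \<le> (1 + card B * s) * (1 + card B * s) ^ length v"
    using 1 Cons(2) s by (intro mult_mono sum_nonneg) auto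
  finally show "(\<Sum>w\<in>W (b # v). s ^ length (filter (\<lambda>a. a \<in> B) w)) \<le> (1 + card B * s) ^ length (b # v)"
    by simp
qed

text \<open>Words with at most \<open>m\<close> exceptional letters have weight at least \<open>s\<^sup>m\<close>, so their
  number is at most the total weight divided by \<open>s\<^sup>m\<close>. If \<open>m\<close> is a small fraction of the length, the
  exponential growth rate of this bound is small for suitable \<open>s\<close>.\<close>

lemma card_list_all2_le:
  fixes s :: real and B :: "'b set" and m :: nat
  assumes B: "finite B" and s: "0 < s" "s \<le> 1"
  defines "W \<equiv> \<lambda>v. {w. list_all2 (\<lambda>a b. a \<in> B \<or> a = b) w v \<and> length (filter (\<lambda>a. a \<in> B) w) \<le> m}"
  shows "finite (W v)" "real (card (W v)) \<le> (1 + card B * s) ^ length v / s ^ m"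
proof -
  let ?W = "{w. list_all2 (\<lambda>a b. a \<in> B \<or> a = b) w v}"
  have fin: "finite ?W" using sum_weights_list_all2(1)[OF B, of s v] s by simp
  have sub: "W v \<subseteq> ?W" by (auto simp: W_def)
  show finW: "finite (W v)" using sub fin by (rule finite_subset)
  have "card (W v) * s ^ m = (\<Sum>w\<in>W v. s ^ m)" by simp
  also have "\<dots> \<le> (\<Sum>w\<in>W v. s ^ length (filter (\<lambda>a. a \<in> B) w))"
    using s by (intro sum_mono power_decreasing) (auto simp: W_def)
  also have "\<dots> \<le> (\<Sum>w\<in>?W. s ^ length (filter (\<lambda>a. a \<in> B) w))"
    using s by (intro sum_mono2 fin sub) auto
  also have "\<dots> \<le> (1 + card B * s) ^ length v"
    using sum_weights_list_all2(2)[OF B, of s v] s by simp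
  finally show "real (card (W v)) \<le> (1 + card B * s) ^ length v / s ^ m"
    using s by (simp add: field_simps)
qed

text \<open>Points with labels outside \<open>B\<close> within \<open>\<delta>\<close> of the same point have the same label. Hence the names
  of the points that stay \<open>\<delta>\<close>-close to a fixed orbit agree with one word, except for letters in \<open>B\<close>.\<close>

lemma card_names_spanned:
  fixes S :: "'a::metric_space set" and p :: "'a \<Rightarrow> 'b" and s :: real and m :: nat
  assumes F: "finite F" and span: "spanning_set S f n \<delta> E F" and E: "E \<subseteq> S"
    and f: "\<And>x. x \<in> S \<Longrightarrow> f x \<in> S"
    and B: "finite B" and s: "0 < s" "s \<le> 1"
    and sep: "\<And>x y. x \<in> S \<Longrightarrow> y \<in> S \<Longrightarrow> p x \<notin> B \<Longrightarrow> p y \<notin> B \<Longrightarrow> dist x y \<le> 2 * \<delta> \<Longrightarrow> p x = p y"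
  defines "W \<equiv> {w \<in> names f p n ` E. length (filter (\<lambda>a. a \<in> B) w) \<le> m}"
  shows "finite W" "real (card W) \<le> card F * ((1 + card B * s) ^ n / s ^ m)"
proof -
  have fi: "(f ^^ i) x \<in> S" if "x \<in> S" for i x
    using that f by (induction i) auto
  \<comment> \<open>The only label outside \<open>B\<close> that points close to \<open>z\<close> can have, if there is any such point.\<close>
  define c where "c z = p (SOME y. y \<in> S \<and> p y \<notin> B \<and> dist y z \<le> \<delta>)" for z
  define C where "C v = {w. list_all2 (\<lambda>a b. a \<in> B \<or> a = b) w v \<and> length (filter (\<lambda>a. a \<in> B) w) \<le> m}" for v
  have c: "p y = c z" if "y \<in> S" "p y \<notin> B" "dist y z \<le> \<delta>" for y z
  proof -
    let ?y = "SOME y. y \<in> S \<and> p y \<notin> B \<and> dist y z \<le> \<delta>"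
    have y: "?y \<in> S \<and> p ?y \<notin> B \<and> dist ?y z \<le> \<delta>"
      by (rule someI[of _ y]) (use that in auto)
    have "dist y ?y \<le> 2 * \<delta>"
      using dist_triangle2[of y ?y z] y that by linarith
    with y that show ?thesis unfolding c_def by (intro sep) auto
  qed
  have sub: "W \<subseteq> (\<Union>z\<in>F. C (names f c n z))"
  proof
    fix w assume "w \<in> W"
    then obtain x where x: "x \<in> E" "w = names f p n x" "length (filter (\<lambda>a. a \<in> B) w) \<le> m"
      by (auto simp: W_def)
    from span x(1) obtain z where z: "z \<in> F" "\<And>k. k < n \<Longrightarrow> dist ((f ^^ k) x) ((f ^^ k) z) \<le> \<delta>"
      unfolding spanning_set_def by blast
    have "list_all2 (\<lambda>a b. a \<in> B \<or> a = b) w (names f c n z)"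
      unfolding list_all2_conv_all_nth using x E z by (auto simp: nth_names intro!: c fi)
    with x z show "w \<in> (\<Union>z\<in>F. C (names f c n z))" by (auto simp: C_def)
  qed
  have finC: "finite (C v)" and cardC: "real (card (C v)) \<le> (1 + card B * s) ^ length v / s ^ m" for v
    unfolding C_def by (rule card_list_all2_le[OF B s])+
  show "finite W" using F finC by (intro finite_subset[OF sub]) auto
  have "card W \<le> card (\<Union>z\<in>F. C (names f c n z))"
    using F finC by (intro card_mono sub) auto
  also have "\<dots> \<le> (\<Sum>z\<in>F. card (C (names f c n z)))"
    by (rule card_UN_le[OF F])
  finally have "real (card W) \<le> (\<Sum>z\<in>F. real (card (C (names f c n z))))"
    by (metis of_nat_le_iff of_nat_sum)
  also have "\<dots> \<le> (\<Sum>z\<in>F. (1 + card B * s) ^ n / s ^ m)"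
    by (intro sum_mono) (use cardC in \<open>metis length_names\<close>)
  finally show "real (card W) \<le> card F * ((1 + card B * s) ^ n / s ^ m)" by simp
qed

section \<open>Spanning sets of sets of zero topological entropy\<close>

lemma ex_finite_spanning:
  fixes S :: "'a::metric_space set"
  assumes S: "compact S" and f: "continuous_on S f" "f \<in> S \<rightarrow> S" and \<delta>: "\<delta> > 0" and E: "E \<subseteq> S"
  shows "\<exists>F. finite F \<and> spanning_set S f n \<delta> E F"
proof -
  have fi: "(f ^^ i) \<in> S \<rightarrow> S \<and> continuous_on S (f ^^ i)" for i
  proof (induction i)
    case (Suc i)
    then have "continuous_on ((f ^^ i) ` S) f"
      using f by (intro continuous_on_subset[OF f(1)]) auto
    with Suc have "continuous_on S (f \<circ> (f ^^ i))"
      by (intro continuous_on_compose) auto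
    with Suc f show ?case by auto
  qed auto
  have "\<exists>\<eta>>0. \<forall>k<n. \<forall>x\<in>S. \<forall>y\<in>S. dist x y < \<eta> \<longrightarrow> dist ((f ^^ k) x) ((f ^^ k) y) < \<delta>"
  proof (induction n)
    case 0
    show ?case by (auto intro: exI[of _ 1])
  next
    case (Suc n)
    then obtain a where a: "a > 0" "\<forall>k<n. \<forall>x\<in>S. \<forall>y\<in>S. dist x y < a \<longrightarrow> dist ((f ^^ k) x) ((f ^^ k) y) < \<delta>"
      by auto
    have "uniformly_continuous_on S (f ^^ n)"
      using S fi by (intro compact_uniformly_continuous) auto
    then obtain b where b: "b > 0" "\<forall>x\<in>S. \<forall>y\<in>S. dist x y < b \<longrightarrow> dist ((f ^^ n) x) ((f ^^ n) y) < \<delta>"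
      using \<delta> unfolding uniformly_continuous_on_def by (metis dist_commute)
    show ?case using a b by (intro exI[of _ "min a b"]) (auto simp: less_Suc_eq)
  qed
  then obtain \<eta> where \<eta>: "\<eta> > 0"
    "\<And>k x y. k < n \<Longrightarrow> x \<in> S \<Longrightarrow> y \<in> S \<Longrightarrow> dist x y < \<eta> \<Longrightarrow> dist ((f ^^ k) x) ((f ^^ k) y) < \<delta>"
    by blast
  obtain F where F: "finite F" "F \<subseteq> S" "S \<subseteq> (\<Union>x\<in>F. ball x \<eta>)"
    using seq_compact_imp_totally_bounded[of S] S \<eta>(1) by (metis compact_eq_seq_compact_metric)
  have "spanning_set S f n \<delta> E F"
    unfolding spanning_set_def
  proof (intro conjI ballI)
    fix x assume "x \<in> E"
    then have "x \<in> S" using E by auto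
    then obtain y where "y \<in> F" "dist y x < \<eta>" using F by (auto simp: mem_ball)
    have "dist ((f ^^ k) x) ((f ^^ k) y) \<le> \<delta>" if "k < n" for k
      using \<eta>(2)[OF that \<open>x \<in> S\<close>, of y] \<open>y \<in> F\<close> \<open>dist y x < \<eta>\<close> F(2)
      by (auto simp: dist_commute)
    with \<open>y \<in> F\<close> show "\<exists>y\<in>F. \<forall>k<n. dist ((f ^^ k) x) ((f ^^ k) y) \<le> \<delta>"
      by blast
  qed (use F in auto)
  with F show ?thesis by blast
qed

text \<open>The exponential growth rate of the spanning numbers increases as \<open>\<delta>\<close> decreases, so the limit
  is a supremum; if it vanishes, the rate is at most 0 for every single \<open>\<delta>\<close>.\<close>

lemma top_entropy_0_spanning:
  fixes S :: "'a::metric_space set"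
  assumes S: "compact S" and f: "continuous_on S f" "f \<in> S \<rightarrow> S" and E: "E \<subseteq> S"
    and top: "top_entropy S f E = 0" and \<delta>: "\<delta> > 0" and t: "t > 0"
  shows "eventually (\<lambda>n. \<exists>F. finite F \<and> spanning_set S f n \<delta> E F \<and> card F \<le> exp (t * real n)) sequentially"
proof -
  let ?C = "\<lambda>n \<delta>. card ` {F. finite F \<and> spanning_set S f n \<delta> E F}"
  have ne: "?C n d \<noteq> {}" if "d > 0" for n d
    using ex_finite_spanning[OF S f that E] by auto
  have r_mono: "min_spanning S f n d' E \<le> min_spanning S f n d E" if "0 < d" "d \<le> d'" for n d d'
  proof -
    have "?C n d \<subseteq> ?C n d'"
      using that unfolding spanning_set_def by (intro image_mono) (auto, meson order_trans)
    then show ?thesis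
      unfolding min_spanning_def using ne[OF that(1)] by (intro cInf_superset_mono) auto
  qed
  define G where "G d = limsup (\<lambda>n. ereal (ln (real (min_spanning S f n d E)) / real n))" for d
  have ln_mono: "ln (real a) \<le> ln (real b)" if "a \<le> b" for a b :: nat
    using that by (cases "a = 0"; cases "b = 0") auto
  have G_mono: "G d' \<le> G d" if "0 < d" "d \<le> d'" for d d'
    unfolding G_def
    by (intro Limsup_mono always_eventually allI) (auto intro!: divide_right_mono ln_mono r_mono that)
  have "(G \<longlongrightarrow> (SUP d\<in>{0<..}. G d)) (at_right 0)"
  proof (rule increasing_tendsto)
    show "eventually (\<lambda>d. G d \<le> (SUP d\<in>{0<..}. G d)) (at_right 0)"
      by (auto simp: eventually_at_right_field intro!: exI[of _ 1] SUP_upper)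
    fix x assume "x < (SUP d\<in>{0<..}. G d)"
    then obtain d where d: "d > 0" "x < G d" by (auto simp: less_SUP_iff)
    show "eventually (\<lambda>d. x < G d) (at_right 0)"
      unfolding eventually_at_right_field
      using d G_mono by (intro exI[of _ d]) (auto intro: less_le_trans less_imp_le)
  qed
  then have "Lim (at_right 0) G = (SUP d\<in>{0<..}. G d)"
    by (intro tendsto_Lim) auto
  with top have "(SUP d\<in>{0<..}. G d) = 0"
    by (simp add: top_entropy_def G_def[abs_def])
  then have "G \<delta> \<le> 0" using \<delta> by (metis SUP_upper greaterThan_iff)
  then have "G \<delta> < ereal t" using t by (simp add: le_less_trans)
  then have "eventually (\<lambda>n. ereal (ln (real (min_spanning S f n \<delta> E)) / real n) < ereal t) sequentially"
    unfolding G_def by (rule Limsup_lessD)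
  then show ?thesis
    using eventually_gt_at_top[of 0]
  proof eventually_elim
    case (elim n)
    have "min_spanning S f n \<delta> E \<in> ?C n \<delta>"
      unfolding min_spanning_def by (rule Inf_nat_def1[OF ne[OF \<delta>]])
    then obtain F where F: "finite F" "spanning_set S f n \<delta> E F" "card F = min_spanning S f n \<delta> E" by auto
    have "ln (real (card F)) < t * real n"
      using elim F by (simp add: field_simps)
    have "real (card F) \<le> exp (t * real n)"
    proof (cases "card F = 0")
      case False
      then have "real (card F) = exp (ln (real (card F)))" by simp
      also have "\<dots> \<le> exp (t * real n)"
        using \<open>ln (real (card F)) < t * real n\<close> by (simp only: exp_le_cancel_iff)
      finally show ?thesis .
    qed simp
    with F show ?case by blast
  qed
qed

section \<open>Small conditional entropy of long names\<close>

text \<open>The expected number of letters in \<open>B\<close> in a name of length \<open>n\<close> is \<open>n\<close> times the measure of the set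
  of points with label in \<open>B\<close>, by invariance. Markov's inequality turns this into a bound of the
  probability of names with many such letters.\<close>

lemma (in prob_space) bad_letters_markov:
  fixes X :: "'a \<Rightarrow> 'b::countable"
  assumes T: "mpt T" and X: "discrete_rv X" and \<tau>: "\<tau> > 0" and B: "prob {x \<in> space M. X x \<in> B} \<le> \<tau>\<^sup>2"
    and m: "\<tau> * real n < real m" and n: "n > 0"
  shows "prob {x \<in> space M. m \<le> length (filter (\<lambda>a. a \<in> B) (names T X n x))} \<le> \<tau>"
proof -
  define h where "h n x = (of_nat (length (filter (\<lambda>a. a \<in> B) (names T X n x))) :: ennreal)" for n x
  have meas: "h n \<in> borel_measurable M" for n
    unfolding h_def by (rule discrete_rv_fun[OF discrete_rv_names[OF T X]]) simp
  have hT: "(\<integral>\<^sup>+x. h n (T x) \<partial>M) = (\<integral>\<^sup>+x. h n x \<partial>M)" for n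
  proof -
    have "(\<integral>\<^sup>+x. h n (T x) \<partial>M) = (\<integral>\<^sup>+x. h n x \<partial>distr M M T)"
      using T meas by (subst nn_integral_distr) (auto simp: mpt_def)
    then show ?thesis using T by (simp add: mpt_def)
  qed
  define A where "A = {x \<in> space M. X x \<in> B}"
  have A: "A \<in> events"
    using measurable_sets[OF X, of B] by (simp add: A_def vimage_def Int_def conj_commute)
  have int: "(\<integral>\<^sup>+x. h n x \<partial>M) = of_nat n * emeasure M A" for n
  proof (induction n)
    case 0
    show ?case by (simp add: h_def)
  next
    case (Suc n)
    have "(\<integral>\<^sup>+x. h (Suc n) x \<partial>M) = (\<integral>\<^sup>+x. indicator A x + h n (T x) \<partial>M)"
      by (intro nn_integral_cong) (auto simp: h_def A_def split: split_indicator)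
    also have "\<dots> = emeasure M A + (\<integral>\<^sup>+x. h n (T x) \<partial>M)"
      using A meas measurable_compose[OF mpt_measurable[OF T] meas]
      by (subst nn_integral_add) auto
    finally show ?case using Suc hT by (simp add: algebra_simps)
  qed
  have m0: "real m > 0" using m \<tau> n by (smt (verit) mult_nonneg_nonneg of_nat_0_le_iff)
  have "{x \<in> space M. m \<le> length (filter (\<lambda>a. a \<in> B) (names T X n x))} =
      {x \<in> space M. 1 \<le> ennreal (1 / real m) * h n x}"
  proof (intro Collect_cong conj_cong refl)
    fix x
    have "ennreal (1 / real m) * h n x = ennreal (real (length (filter (\<lambda>a. a \<in> B) (names T X n x))) / real m)"
      by (simp add: h_def ennreal_of_nat_eq_real_of_nat ennreal_mult[symmetric])
    then show "m \<le> length (filter (\<lambda>a. a \<in> B) (names T X n x)) \<longleftrightarrow> 1 \<le> ennreal (1 / real m) * h n x"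
      using m0 by (simp add: field_simps)
  qed
  then have "emeasure M {x \<in> space M. m \<le> length (filter (\<lambda>a. a \<in> B) (names T X n x))} \<le>
      ennreal (1 / real m) * (\<integral>\<^sup>+x. h n x * indicator (space M) x \<partial>M)"
    using nn_integral_Markov_inequality[of "h n" "space M" M "ennreal (1 / real m)"] meas by simp
  also have "(\<integral>\<^sup>+x. h n x * indicator (space M) x \<partial>M) = (\<integral>\<^sup>+x. h n x \<partial>M)"
    by (intro nn_integral_cong) simp
  also have "ennreal (1 / real m) * \<dots> = ennreal (1 / real m * (real n * prob A))"
    unfolding int emeasure_eq_measure ennreal_of_nat_eq_real_of_nat
    by (subst ennreal_mult, simp, simp, subst ennreal_mult, simp, simp, rule refl)
  finally have "prob {x \<in> space M. m \<le> length (filter (\<lambda>a. a \<in> B) (names T X n x))}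
      \<le> 1 / real m * (real n * prob A)"
    by (simp add: emeasure_eq_measure)
  also have "\<dots> \<le> 1 / real m * (real n * \<tau>\<^sup>2)"
    using B by (intro mult_left_mono) (auto simp: A_def)
  also have "\<dots> \<le> \<tau>"
  proof -
    have "real n * \<tau>\<^sup>2 = \<tau> * (\<tau> * real n)" by (simp add: power2_eq_square)
    also have "\<dots> \<le> \<tau> * real m" using \<tau> m by (intro mult_left_mono) auto
    finally show ?thesis using m0 by (simp add: field_simps)
  qed
  finally show ?thesis .
qed

lemma compact_closed_separated:
  fixes C D :: "'a::metric_space set"
  assumes C: "compact C" and D: "closed D" and disj: "C \<inter> D = {}"
  shows "\<exists>d>0. \<forall>x\<in>C. \<forall>y\<in>D. d \<le> dist x y"
proof (cases "C = {} \<or> D = {}")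
  case False
  have "continuous_on C (\<lambda>x. infdist x D)" by (intro continuous_intros)
  with C False obtain x where x: "x \<in> C" "\<And>y. y \<in> C \<Longrightarrow> infdist x D \<le> infdist y D"
    using continuous_attains_inf[of C "\<lambda>x. infdist x D"] by auto
  have "infdist x D > 0" using D False disj x by (intro infdist_pos_not_in_closed) auto
  moreover have "infdist x D \<le> dist y z" if "y \<in> C" "z \<in> D" for y z
    using x(2)[OF that(1)] infdist_le[OF that(2), of y] by linarith
  ultimately show ?thesis by blast
qed (auto intro: exI[of _ 1])

context compact_prob_space
begin

text \<open>By Lusin's theorem the level sets of \<open>p\<close> meet a set \<open>K\<close> of almost full measure in compact sets,
  finitely many, pairwise at positive distance. The additional component of \<open>p'\<close> records whether
  the point is in \<open>K\<close>, so that leaving \<open>K\<close> is visible in the names.\<close>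

lemma well_separated_refinement:
  fixes p :: "'a \<Rightarrow> 'b::countable"
  assumes p: "discrete_rv p" and R: "finite R" "\<And>x. x \<in> space M \<Longrightarrow> p x \<in> R" and \<eta>: "\<eta> > 0"
  obtains p' :: "'a \<Rightarrow> 'b \<times> bool" and \<delta> :: real where "discrete_rv p'" "\<And>x. fst (p' x) = p x"
    "prob {x \<in> space M. p' x \<in> R \<times> {False}} \<le> \<eta>" "\<delta> > 0"
    "\<And>x y. x \<in> space M \<Longrightarrow> y \<in> space M \<Longrightarrow> p' x \<notin> R \<times> {False} \<Longrightarrow> p' y \<notin> R \<times> {False} \<Longrightarrow>
       dist x y \<le> 2 * \<delta> \<Longrightarrow> p' x = p' y"
proof -
  obtain K where K: "closed K" "K \<subseteq> space M" "prob (space M - K) < \<eta>" "\<And>i v. closed {x \<in> K. p x = v}"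
    by (rule lusin[of "\<lambda>_::unit. p", OF p \<eta>]) (rule that)
  define C where "C v = {x \<in> K. p x = v}" for v
  have cpt: "compact (C v)" for v
  proof -
    have "C v = space M \<inter> C v" using K(2) by (auto simp: C_def)
    also have "compact \<dots>" using K(4) by (intro compact_Int_closed compact_space) (auto simp: C_def)
    finally show ?thesis .
  qed
  have "\<exists>d>0. v \<noteq> w \<longrightarrow> (\<forall>x\<in>C v. \<forall>y\<in>C w. d \<le> dist x y)" for v w
  proof (cases "v = w")
    case False
    then have "C v \<inter> C w = {}" by (auto simp: C_def)
    from compact_closed_separated[OF cpt compact_imp_closed[OF cpt] this] show ?thesis by blast
  qed (auto intro: exI[of _ 1])
  then obtain d where d: "\<And>v w. d v w > 0" "\<And>v w x y. v \<noteq> w \<Longrightarrow> x \<in> C v \<Longrightarrow> y \<in> C w \<Longrightarrow> d v w \<le> dist x y"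
    by metis
  define D where "D = Min (insert 1 ((\<lambda>(v, w). d v w) ` (R \<times> R)))"
  have D: "D > 0" "\<And>v w. v \<in> R \<Longrightarrow> w \<in> R \<Longrightarrow> D \<le> d v w"
    unfolding D_def using R(1) d(1) by (auto intro!: Min_le)
  define p' where "p' x = (p x, x \<in> K)" for x
  show ?thesis
  proof (rule that[of p' "D / 4"])
    have "discrete_rv (\<lambda>x. x \<in> K)"
      using closed_events[OF K(1,2)] by (simp add: pred_def[symmetric] pred_sets1)
    then show "discrete_rv p'" unfolding p'_def by (intro discrete_rv_Pair p)
    have "{x \<in> space M. p' x \<in> R \<times> {False}} = space M - K"
      using R by (auto simp: p'_def)
    with K show "prob {x \<in> space M. p' x \<in> R \<times> {False}} \<le> \<eta>" by simp
    show "D / 4 > 0" using D by simp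
    fix x y assume *: "x \<in> space M" "y \<in> space M" "p' x \<notin> R \<times> {False}" "p' y \<notin> R \<times> {False}"
       "dist x y \<le> 2 * (D / 4)"
    then have "x \<in> C (p x)" "y \<in> C (p y)" using R by (auto simp: C_def p'_def)
    with * d(2)[of "p x" "p y" x y] D(1) D(2)[of "p x" "p y"] R(2) have "p x = p y" by force
    with \<open>x \<in> C (p x)\<close> \<open>y \<in> C (p y)\<close> show "p' x = p' y" by (auto simp: C_def p'_def)
  qed (simp add: p'_def)
qed

text \<open>This is the core of the argument. The variables \<open>b k\<close> are increasingly fine, and the
  fibres of all of them together are spanned by few points, hence realise few names, up to names with
  too many letters in \<open>B\<close>. After restriction to a compact set on which everything is continuous, a
  name that is realised in the fibre of \<open>b k\<close> through \<open>x\<close> for every \<open>k\<close> is realised in the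
  intersection of these fibres. So already the fibre of a single \<open>b k\<close> realises few names, for most
  points, and guessing uniformly among them bounds the conditional entropy given \<open>b k\<close>.\<close>

lemma cond_ent_names_small:
  fixes p :: "'a \<Rightarrow> 'b::countable" and b :: "nat \<Rightarrow> 'a \<Rightarrow> 'c::countable" and \<tau> s \<delta> :: real
  assumes T: "mpt T" and p: "discrete_rv p" and R: "finite R" "\<And>x. x \<in> space M \<Longrightarrow> p x \<in> R"
    and \<tau>: "\<tau> > 0" and s: "0 < s" "s \<le> 1"
    and B: "finite B" "prob {x \<in> space M. p x \<in> B} \<le> \<tau>\<^sup>2"
    and sep: "\<And>x y. x \<in> space M \<Longrightarrow> y \<in> space M \<Longrightarrow> p x \<notin> B \<Longrightarrow> p y \<notin> B \<Longrightarrow> dist x y \<le> 2 * \<delta> \<Longrightarrow> p x = p y"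
    and b: "\<And>k. discrete_rv (b k)"
    and refine: "\<And>k x y. x \<in> space M \<Longrightarrow> y \<in> space M \<Longrightarrow> b (Suc k) x = b (Suc k) y \<Longrightarrow> b k x = b k y"
    and span: "AE x in M. \<forall>\<^sub>F n in sequentially. \<exists>F. finite F \<and>
       spanning_set (space M) T n \<delta> {y \<in> space M. \<forall>k. b k y = b k x} F \<and> card F \<le> exp (\<tau> * real n)"
  obtains N k where "N > 0" "cond_ent (names T p N) (b k) \<le>
    ennreal (real N * (2 * \<tau> + ln (1 + card B * s) + \<tau> * ln (1 / s) + 2 * \<tau> * ln (card R)))"
proof -
  have Ts: "T x \<in> space M" if "x \<in> space M" for x
    using mpt_measurable[OF T] that by (rule measurable_space)
  have Ti: "(T ^^ i) x \<in> space M" if "x \<in> space M" for i x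
    using that Ts by (induction i) auto
  note np = discrete_rv_names[OF T p]
  \<comment> \<open>Both families are put into one, so that one compact set makes all of them continuous.\<close>
  define X where "X i x = (case i of Inl k \<Rightarrow> Inl (b k x) | Inr n \<Rightarrow> Inr (names T p n x))"
    for i :: "nat + nat" and x
  have "discrete_rv (X i)" for i
  proof (cases i)
    case (Inl k)
    then show ?thesis
      using discrete_rv_fun[OF b[of k], of Inl "count_space UNIV"] by (simp add: X_def[abs_def])
  next
    case (Inr n)
    then show ?thesis
      using discrete_rv_fun[OF np[of n], of Inr "count_space UNIV"] by (simp add: X_def[abs_def])
  qed
  note X = this
  obtain L where L: "closed L" "L \<subseteq> space M" "prob (space M - L) < \<tau>" "\<And>i v. closed {x \<in> L. X i x = v}"
    by (rule lusin[of X, OF X \<tau>]) (rule that)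
  have clb: "closed {x \<in> L. b k x = v}" for k v
    using L(4)[of "Inl k" "Inl v"] by (simp add: X_def)
  have cln: "closed {x \<in> L. names T p n x = w}" for n w
    using L(4)[of "Inr n" "Inr w"] by (simp add: X_def)
  have cptL: "compact L"
    using compact_Int_closed[OF compact_space L(1)] L(2) by (simp add: Int_absorb1)
  have evL: "L \<in> events" by (rule closed_events[OF L(1,2)])
  define bad where "bad w = length (filter (\<lambda>a. a \<in> B) w)" for w
  define m where "m n = nat \<lfloor>\<tau> * real n\<rfloor>" for n :: nat
  have m_le: "real (m n) \<le> \<tau> * real n" for n using \<tau> by (simp add: m_def)
  have m_gt: "\<tau> * real n < real (Suc (m n))" for n
    using \<tau> by (simp add: m_def) linarith
  \<comment> \<open>The bound of \<open>card_names_spanned\<close> for at most \<open>exp (\<tau> * n)\<close> spanning points.\<close>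
  define bnd where "bnd n = exp (\<tau> * real n) * ((1 + card B * s) ^ n / s ^ m n)" for n
  have bnd1: "bnd n \<ge> 1" for n
  proof -
    have "1 \<le> (1 + card B * s) ^ n" using s by (intro one_le_power) auto
    moreover have "s ^ m n \<le> 1" "s ^ m n > 0" using s by (auto intro: power_le_one)
    ultimately have "1 \<le> (1 + card B * s) ^ n / s ^ m n" by (simp add: field_simps)
    moreover have "1 \<le> exp (\<tau> * real n)" using \<tau> by simp
    ultimately show ?thesis unfolding bnd_def by (metis mult_mono mult_1 exp_ge_zero zero_le_one)
  qed
  \<comment> \<open>The names of length \<open>n\<close> with few letters in \<open>B\<close> that are realised in \<open>L\<close> by points with
    \<open>b k = v\<close>; the set \<open>E k n\<close> below consists of the points of \<open>L\<close> whose fibre realises few of them.\<close>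
  define S where "S k n v = {w. bad w \<le> m n \<and> (\<exists>y\<in>L. b k y = v \<and> names T p n y = w)}" for k n v
  define lR where "lR n = {w. set w \<subseteq> R \<and> length w = n}" for n
  have finR: "finite (lR n)" and cardR: "card (lR n) = card R ^ n" for n
    unfolding lR_def using R(1) by (auto intro: finite_lists_length_eq card_lists_length_eq)
  have names_R: "names T p n x \<in> lR n" if "x \<in> space M" for n x
    using that R(2) Ti by (auto simp: lR_def in_set_conv_nth nth_names)
  have S_R: "S k n v \<subseteq> lR n" for k n v
    using names_R L(2) by (auto simp: S_def)
  have finS: "finite (S k n v)" for k n v using S_R finR by (rule finite_subset)
  have b_refine: "b k x = b k y" if "k \<le> j" "x \<in> space M" "y \<in> space M" "b j x = b j y" for j k x y
    using that by (induction rule: dec_induct) (auto dest: refine)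
  have S_mono: "S j n (b j x) \<subseteq> S k n (b k x)" if "k \<le> j" "x \<in> space M" for j k n x
  proof
    fix w assume "w \<in> S j n (b j x)"
    then obtain y where y: "bad w \<le> m n" "y \<in> L" "b j y = b j x" "names T p n y = w"
      by (auto simp: S_def)
    then have "b k y = b k x" using that L(2) by (intro b_refine[of k j]) auto
    with y show "w \<in> S k n (b k x)" by (auto simp: S_def)
  qed
  define E where "E k n = {x \<in> L. real (card (S k n (b k x))) \<le> bnd n}" for k n
  have E_events: "E k n \<in> events" for k n
  proof -
    have "E k n = L \<inter> (b k -` {v. real (card (S k n v)) \<le> bnd n} \<inter> space M)"
      using L(2) by (auto simp: E_def)
    then show ?thesis using evL measurable_sets[OF b[of k], of "{v. real (card (S k n v)) \<le> bnd n}"] by auto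
  qed
  have E_mono: "E k n \<subseteq> E j n" if "k \<le> j" for j k n
  proof
    fix x assume x: "x \<in> E k n"
    then have "card (S j n (b j x)) \<le> card (S k n (b k x))"
      using L(2) by (intro card_mono finS S_mono that) (auto simp: E_def)
    with x show "x \<in> E j n" by (auto simp: E_def)
  qed
  have compactness: "\<exists>k. x \<in> E k n"
    if x: "x \<in> L" and F: "finite F" "spanning_set (space M) T n \<delta> {y \<in> space M. \<forall>k. b k y = b k x} F"
      "card F \<le> exp (\<tau> * real n)" for x n F
  proof -
    define Z where "Z = {y \<in> L. \<forall>k. b k y = b k x}"
    have spanZ: "spanning_set (space M) T n \<delta> Z F"
      using F(2) L(2) unfolding spanning_set_def Z_def by blast
    define W where "W = {w \<in> names T p n ` Z. length (filter (\<lambda>a. a \<in> B) w) \<le> m n}"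
    have ZM: "Z \<subseteq> space M" using L(2) by (auto simp: Z_def)
    have cardW: "finite W" "real (card W) \<le> bnd n"
    proof -
      show "finite W"
        unfolding W_def by (rule card_names_spanned(1)[OF F(1) spanZ ZM Ts B(1) s sep])
      have "real (card W) \<le> card F * ((1 + card B * s) ^ n / s ^ m n)"
        unfolding W_def by (rule card_names_spanned(2)[OF F(1) spanZ ZM Ts B(1) s sep])
      also have "\<dots> \<le> bnd n" unfolding bnd_def using F(3) s by (intro mult_right_mono) auto
      finally show "real (card W) \<le> bnd n" .
    qed
    \<comment> \<open>The decreasing sequence of finite sets of names becomes constant where its cardinality is
      minimal. Every name in the minimal set is realised for all \<open>j\<close>, so by compactness on a common
      point of all the fibres.\<close>
    obtain k where k: "\<And>j. card (S k n (b k x)) \<le> card (S j n (b j x))"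
      using ex_has_least_nat[of "\<lambda>_. True" 0 "\<lambda>k. card (S k n (b k x))"] by auto
    have const: "S k n (b k x) \<subseteq> S j n (b j x)" for j
    proof -
      have x': "x \<in> space M" using x L(2) by auto
      have "S (max k j) n (b (max k j) x) = S k n (b k x)"
        using k[of "max k j"] by (intro card_seteq finS S_mono x') auto
      moreover have "S (max k j) n (b (max k j) x) \<subseteq> S j n (b j x)" by (intro S_mono x') auto
      ultimately show ?thesis by simp
    qed
    have "S k n (b k x) \<subseteq> W"
    proof
      fix w assume w: "w \<in> S k n (b k x)"
      define A where "A j = {y \<in> L. b j y = b j x} \<inter> {y \<in> L. names T p n y = w}" for j
      have A_mono: "A j \<subseteq> A i" if "i \<le> j" for i j
        using that x L(2) by (auto simp: A_def intro: b_refine)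
      have A_ne: "A j \<noteq> {}" for j
        using const[of j] w by (auto simp: S_def A_def)
      have "L \<inter> (\<Inter>j\<in>UNIV. A j) \<noteq> {}"
      proof (rule compact_imp_fip_image[OF cptL])
        show "closed (A j)" for j unfolding A_def by (intro closed_Int clb cln)
        fix I :: "nat set" assume I: "finite I" "I \<subseteq> UNIV"
        have "A (Max (insert 0 I)) \<subseteq> L \<inter> (\<Inter>j\<in>I. A j)"
        proof
          fix y assume y: "y \<in> A (Max (insert 0 I))"
          have "y \<in> A j" if "j \<in> I" for j
            using A_mono[of j "Max (insert 0 I)"] y that I by auto
          moreover have "y \<in> L" using y by (auto simp: A_def)
          ultimately show "y \<in> L \<inter> (\<Inter>j\<in>I. A j)" by blast
        qed
        with A_ne show "L \<inter> (\<Inter>j\<in>I. A j) \<noteq> {}" by blast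
      qed
      then obtain y where "y \<in> L" "\<And>j. y \<in> A j" by blast
      then have "y \<in> Z" "names T p n y = w" by (auto simp: A_def Z_def)
      then show "w \<in> W" using w by (auto simp: W_def S_def bad_def)
    qed
    then have "card (S k n (b k x)) \<le> card W" by (intro card_mono cardW)
    with cardW x have "x \<in> E k n" by (auto simp: E_def)
    then show ?thesis ..
  qed
  \<comment> \<open>The set of points whose fibres are spanned by few points from the time \<open>N\<close> on need not be measurable;
    the sets \<open>D N\<close> are, and they cover almost all of \<open>L\<close>.\<close>
  define D where "D N = (\<Inter>n\<in>{N..}. \<Union>k. E k n)" for N :: nat
  have D_events: "D N \<in> events" for N
    unfolding D_def using E_events by (intro sets.countable_INT' sets.countable_UN) auto
  have "prob L \<le> prob (\<Union>N. D N)"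
  proof (rule finite_measure_mono_AE)
    show "AE x in M. x \<in> L \<longrightarrow> x \<in> (\<Union>N. D N)"
      using span
    proof eventually_elim
      case (elim x)
      show ?case
      proof
        assume x: "x \<in> L"
        from elim obtain N where "\<And>n. n \<ge> N \<Longrightarrow> \<exists>F. finite F \<and>
           spanning_set (space M) T n \<delta> {y \<in> space M. \<forall>k. b k y = b k x} F \<and> card F \<le> exp (\<tau> * real n)"
          by (auto simp: eventually_sequentially)
        then have "x \<in> D N" unfolding D_def using compactness[OF x] by blast
        then show "x \<in> (\<Union>N. D N)" by blast
      qed
    qed
    show "(\<Union>N. D N) \<in> events" using D_events by auto
  qed
  moreover have "prob L > 1 - \<tau>" using L(3) prob_compl[OF evL] by simp
  ultimately have "1 - \<tau> < prob (\<Union>N. D N)" by simp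
  moreover have "(\<lambda>N. prob (D N)) \<longlonglongrightarrow> prob (\<Union>N. D N)"
    using D_events by (intro finite_Lim_measure_incseq) (auto simp: incseq_def D_def)
  ultimately have "eventually (\<lambda>N. 1 - \<tau> < prob (D N)) sequentially"
    by (intro order_tendstoD)
  moreover obtain N0 where "1 / \<tau> < real N0" using reals_Archimedean2 by blast
  ultimately obtain N where N: "1 - \<tau> < prob (D N)" "1 / \<tau> < real N"
    unfolding eventually_sequentially by (metis le_cases of_nat_mono order_less_le_trans)
  have N0: "N > 0" using N(2) \<tau> by (cases N) (auto simp: field_simps)
  have "prob (D N) \<le> prob (\<Union>k. E k N)"
    using E_events by (intro finite_measure_mono) (auto simp: D_def)
  with N have "1 - \<tau> < prob (\<Union>k. E k N)" by simp
  moreover have "(\<lambda>k. prob (E k N)) \<longlonglongrightarrow> prob (\<Union>k. E k N)"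
    using E_events E_mono by (intro finite_Lim_measure_incseq) (auto simp: incseq_def)
  ultimately have "eventually (\<lambda>k. 1 - \<tau> < prob (E k N)) sequentially"
    by (intro order_tendstoD)
  then obtain k where k: "1 - \<tau> < prob (E k N)" by (auto simp: eventually_sequentially)
  define H where "H = {x \<in> space M. Suc (m N) \<le> bad (names T p N x)}"
  have H_events: "H \<in> events"
    using measurable_sets[OF np[of N], of "{w. Suc (m N) \<le> bad w}"]
    by (simp add: H_def vimage_def Int_def conj_commute)
  have H: "prob H \<le> \<tau>"
    unfolding H_def bad_def by (rule bad_letters_markov[OF T p \<tau> B(2) m_gt N0])
  define U where "U = (space M - E k N) \<union> H"
  have U_events: "U \<in> events" unfolding U_def using E_events H_events by auto
  have U: "prob U \<le> 2 * \<tau>"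
  proof -
    have "prob U \<le> prob (space M - E k N) + prob H"
      unfolding U_def using E_events H_events by (intro measure_Un_le) auto
    then show ?thesis using H k prob_compl[OF E_events[of k N]] by simp
  qed
  obtain x0 where "x0 \<in> space M" using not_empty by auto
  then have cR: "card R \<ge> 1" using R by (metis One_nat_def Suc_leI card_gt_0_iff empty_iff)
  \<comment> \<open>An average of two guesses: the first is uniform on the names realised in the fibre if these
    are few, and pays off outside the small set \<open>U\<close>; the second is uniform on all words and keeps the
    cost on \<open>U\<close> linear in \<open>N\<close>. Averaging costs \<open>ln 2\<close>.\<close>
  define q where "q w v = (if w \<in> S k N v \<and> card (S k N v) \<le> bnd N then 1 / (2 * bnd N) else 0) +
      (if w \<in> lR N then 1 / (2 * real (card R) ^ N) else 0)" for w v
  have "cond_ent (names T p N) (b k) \<le> (\<integral>\<^sup>+x. ennreal (- ln (q (names T p N x) (b k x))) \<partial>M)"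
  proof (rule gibbs_inequality[OF np b])
    fix v
    have "(\<integral>\<^sup>+w. ennreal (q w v) \<partial>count_space UNIV) = (\<Sum>w\<in>lR N. ennreal (q w v))"
      using finR S_R[of k N v] bnd1[of N] by (intro nn_integral_count_space') (auto simp: q_def)
    also have "\<dots> = ennreal (\<Sum>w\<in>lR N. q w v)"
      using bnd1[of N] by (intro sum_ennreal) (auto simp: q_def)
    also have "\<dots> \<le> 1"
    proof -
      have "(\<Sum>w\<in>lR N. (if w \<in> S k N v \<and> card (S k N v) \<le> bnd N then 1 / (2 * bnd N) else 0)) =
          (\<Sum>w\<in>S k N v. (if card (S k N v) \<le> bnd N then 1 / (2 * bnd N) else 0))"
        using S_R by (intro sum.mono_neutral_cong_right finR) auto
      also have "\<dots> \<le> 1 / 2" using bnd1[of N] by (simp add: field_simps)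
      finally have 1: "(\<Sum>w\<in>lR N. (if w \<in> S k N v \<and> card (S k N v) \<le> bnd N then 1 / (2 * bnd N) else 0)) \<le> 1 / 2" .
      have "(\<Sum>w\<in>lR N. (if w \<in> lR N then 1 / (2 * real (card R) ^ N) else 0)) = 1 / 2"
        using cR by (simp add: cardR)
      with 1 have "(\<Sum>w\<in>lR N. q w v) \<le> 1" unfolding q_def sum.distrib by linarith
      then show ?thesis by (simp add: ennreal_le_1)
    qed
    finally show "(\<integral>\<^sup>+w. ennreal (q w v) \<partial>count_space UNIV) \<le> 1" .
  next
    show "AE x in M. 0 < q (names T p N x) (b k x)"
      using bnd1[of N] cR names_R by (intro AE_I2) (auto simp: q_def intro!: add_nonneg_pos)
  qed
  also have "\<dots> \<le> (\<integral>\<^sup>+x. ennreal (ln 2 + ln (bnd N)) + ennreal (N * ln (card R)) * indicator U x \<partial>M)"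
  proof (rule nn_integral_mono)
    fix x assume x: "x \<in> space M"
    define q0 where "q0 = q (names T p N x) (b k x)"
    have lnb: "ln (bnd N) \<ge> 0" using bnd1 by simp
    have lR: "ln (card R) \<ge> 0" using cR by simp
    show "ennreal (- ln (q (names T p N x) (b k x))) \<le>
        ennreal (ln 2 + ln (bnd N)) + ennreal (N * ln (card R)) * indicator U x"
    proof (cases "x \<in> U")
      case True
      have "1 / (2 * real (card R) ^ N) \<le> q0"
        unfolding q0_def q_def using names_R[OF x] bnd1[of N] by auto
      then have "ln (1 / (2 * real (card R) ^ N)) \<le> ln q0"
        using cR by (subst ln_le_cancel_iff) (auto intro: less_le_trans[rotated])
      then have "- ln q0 \<le> ln 2 + N * ln (card R)"
        using cR by (simp add: ln_div ln_mult ln_realpow)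
      then have "- ln q0 \<le> ln 2 + ln (bnd N) + N * ln (card R)" using lnb by simp
      then have "ennreal (- ln q0) \<le> ennreal (ln 2 + ln (bnd N) + N * ln (card R))" by (rule ennreal_leI)
      also have "\<dots> = ennreal (ln 2 + ln (bnd N)) + ennreal (N * ln (card R))"
        using lnb lR by (intro ennreal_plus) auto
      finally show ?thesis using True by (simp add: q0_def)
    next
      case False
      then have xE: "x \<in> E k N" and xH: "x \<notin> H" using x by (auto simp: U_def)
      have "names T p N x \<in> S k N (b k x)" using xE xH x by (auto simp: S_def E_def H_def)
      then have "1 / (2 * bnd N) \<le> q0"
        unfolding q0_def q_def using xE cR by (auto simp: E_def)
      then have "ln (1 / (2 * bnd N)) \<le> ln q0"
        using bnd1[of N] by (subst ln_le_cancel_iff) (auto intro: less_le_trans[rotated])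
      then have "- ln q0 \<le> ln 2 + ln (bnd N)"
        using bnd1[of N] by (simp add: ln_div ln_mult)
      then show ?thesis using False by (simp add: q0_def ennreal_leI)
    qed
  qed
  also have "\<dots> = ennreal (ln 2 + ln (bnd N)) + ennreal (N * ln (card R)) * emeasure M U"
    using U_events by (subst nn_integral_add) (auto simp: emeasure_space_1 nn_integral_cmult_indicator)
  also have "\<dots> = ennreal (ln 2 + ln (bnd N) + N * ln (card R) * prob U)"
  proof -
    have "ln (bnd N) \<ge> 0" "N * ln (card R) \<ge> 0" using bnd1 cR by auto
    then show ?thesis by (simp add: emeasure_eq_measure ennreal_mult[symmetric] ennreal_plus[symmetric] del: ennreal_plus)
  qed
  also have "\<dots> \<le> ennreal (real N * (2 * \<tau> + ln (1 + card B * s) + \<tau> * ln (1 / s) + 2 * \<tau> * ln (card R)))"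
  proof (rule ennreal_leI)
    have lnR: "N * ln (card R) * prob U \<le> N * ln (card R) * (2 * \<tau>)"
      using U cR by (intro mult_left_mono) auto
    have ln2: "ln 2 \<le> real N * \<tau>"
    proof -
      have "ln (2::real) \<le> 1" using ln_le_minus_one[of "2::real"] by simp
      also have "1 \<le> real N * \<tau>" using N(2) \<tau> by (simp add: field_simps)
      finally show ?thesis .
    qed
    have c: "1 + card B * s > 0" using s by (simp add: add_pos_nonneg)
    have "ln (bnd N) = \<tau> * real N + (N * ln (1 + card B * s) - m N * ln s)"
      unfolding bnd_def using c s by (simp add: ln_mult ln_div ln_realpow)
    moreover have "- (m N * ln s) \<le> \<tau> * real N * ln (1 / s)"
    proof -
      have "real (m N) * ln (1 / s) \<le> \<tau> * real N * ln (1 / s)"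
        using m_le s by (intro mult_right_mono) auto
      then show ?thesis using s by (simp add: ln_div)
    qed
    ultimately have "ln (bnd N) \<le> real N * (\<tau> + ln (1 + card B * s) + \<tau> * ln (1 / s))"
      by (simp add: algebra_simps)
    with lnR ln2 show "ln 2 + ln (bnd N) + N * ln (card R) * prob U \<le>
      real N * (2 * \<tau> + ln (1 + card B * s) + \<tau> * ln (1 / s) + 2 * \<tau> * ln (card R))"
      by (simp add: algebra_simps)
  qed
  finally show ?thesis by (rule that[OF N0])
qed

end

section \<open>Comparison of entropies\<close>

text \<open>Think of \<open>b x\<close> as the labels \<open>a\<close> along the orbit of \<open>x\<close> from time \<open>- k\<close> to time \<open>k\<close>. A name of
  length \<open>n * N\<close> consists of \<open>n\<close> blocks, names of length \<open>N\<close>. Shifted by \<open>k\<close>, the \<open>q\<close>-th block starts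
  at time \<open>q * N + k\<close>, and it is predicted from the letters of \<open>a\<close> at times \<open>q * N\<close> to
  \<open>q * N + 2 * k\<close>, all of which belong to one name of length \<open>n * N + 2 * k + 1\<close>.\<close>

lemma (in prob_space) ent_names_block_le:
  fixes p :: "'a \<Rightarrow> 'b::countable" and a :: "'a \<Rightarrow> 'c::countable"
  assumes f: "mpt f" and p: "discrete_rv p" and a: "discrete_rv a" and b: "discrete_rv b"
    and b_eq: "\<And>x. x \<in> space M \<Longrightarrow> b ((f ^^ k) x) = names f a (2 * k + 1) x"
  shows "ent (names f p (n * N)) \<le>
    ent (names f a (n * N + (2 * k + 1))) + of_nat n * cond_ent (names f p N) b"
proof -
  note np = discrete_rv_names[OF f p] and na = discrete_rv_names[OF f a]
  note fk = mpt_funpow[OF f, of k] and fN = mpt_funpow[OF f, of N]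
  define X where "X x = names f p N ((f ^^ k) x)" for x
  define Y where "Y = names f a (2 * k + 1)"
  have X: "discrete_rv X" unfolding X_def by (rule mpt_discrete_rv[OF fk np])
  have Y: "discrete_rv Y" unfolding Y_def by (rule na)
  have pow: "((f ^^ N) ^^ q) x = (f ^^ (N * q)) x" for q x by (simp add: funpow_mult)
  have add: "(f ^^ i) ((f ^^ j) x) = (f ^^ (i + j)) x" for i j x by (simp add: funpow_add)
  have "ent (names f p (n * N)) = ent (\<lambda>x. names f p (n * N) ((f ^^ k) x))"
    by (rule ent_mpt[OF fk np, symmetric])
  also have "\<dots> \<le> ent (names (f ^^ N) X n)"
  proof (intro ent_mono mpt_discrete_rv[OF fk] np discrete_rv_names[OF fN] X)
    fix x y assume eq: "names (f ^^ N) X n x = names (f ^^ N) X n y"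
    have "p ((f ^^ j) ((f ^^ k) x)) = p ((f ^^ j) ((f ^^ k) y))" if j: "j < n * N" for j
    proof -
      have q: "j div N < n" "j mod N < N" using j
        by (auto simp: less_mult_imp_div_less intro!: mod_less_divisor) (cases N; simp)
      then have "X ((f ^^ (N * (j div N))) x) = X ((f ^^ (N * (j div N))) y)"
        using eq by (auto simp: names_eq_iff pow)
      then have "p ((f ^^ (j mod N + (k + N * (j div N)))) x) = p ((f ^^ (j mod N + (k + N * (j div N)))) y)"
        using q(2) by (auto simp: X_def names_eq_iff add)
      moreover have "j mod N + (k + N * (j div N)) = j + k" by simp
      ultimately show ?thesis by (simp add: add)
    qed
    then show "names f p (n * N) ((f ^^ k) x) = names f p (n * N) ((f ^^ k) y)"
      by (auto simp: names_eq_iff)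
  qed
  also have "\<dots> \<le> ent (names (f ^^ N) Y n) + of_nat n * cond_ent X Y"
    by (rule ent_names_le[OF fN X Y])
  also have "\<dots> \<le> ent (names f a (n * N + (2 * k + 1))) + of_nat n * cond_ent (names f p N) b"
  proof (intro add_mono mult_left_mono)
    show "ent (names (f ^^ N) Y n) \<le> ent (names f a (n * N + (2 * k + 1)))"
    proof (intro ent_mono na discrete_rv_names[OF fN] Y)
      fix x y assume eq: "names f a (n * N + (2 * k + 1)) x = names f a (n * N + (2 * k + 1)) y"
      have "a ((f ^^ (i + N * q)) x) = a ((f ^^ (i + N * q)) y)" if "q < n" "i < 2 * k + 1" for q i
      proof -
        have "N * q \<le> n * N" using that by simp
        then have "i + N * q < n * N + (2 * k + 1)" using that by linarith
        with eq show ?thesis by (simp add: names_eq_iff del: One_nat_def)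
      qed
      then show "names (f ^^ N) Y n x = names (f ^^ N) Y n y"
        unfolding names_eq_iff Y_def pow add by blast
    qed
    have "cond_ent X Y \<le> cond_ent X (\<lambda>x. b ((f ^^ k) x))"
      by (intro cond_ent_antimono X Y mpt_discrete_rv[OF fk] b) (simp add: b_eq Y_def)
    also have "\<dots> = cond_ent (names f p N) b"
      unfolding X_def by (rule cond_ent_mpt[OF fk np b])
    finally show "cond_ent X Y \<le> cond_ent (names f p N) b" .
  qed auto
  finally show ?thesis .
qed

context compact_prob_space
begin

text \<open>The fibres in the hypothesis consist of the points with the same labels \<open>a\<close> as \<open>x\<close> along the whole
  two-sided orbit.\<close>

lemma rate_le_of_spanning:
  fixes p :: "'a \<Rightarrow> 'b::countable" and a :: "'a \<Rightarrow> 'c::countable"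
  assumes f: "mpt f" and g: "mpt g" and fg: "\<And>x. x \<in> space M \<Longrightarrow> f (g x) = x"
    and gf: "\<And>x. x \<in> space M \<Longrightarrow> g (f x) = x"
    and p: "discrete_rv p" and R: "finite R" "\<And>x. x \<in> space M \<Longrightarrow> p x \<in> R"
    and a: "discrete_rv a" "ent a < \<infinity>"
    and span: "AE x in M. \<forall>\<delta>>0. \<forall>t>0. \<forall>\<^sub>F n in sequentially. \<exists>F. finite F \<and>
       spanning_set (space M) f n \<delta>
         {y \<in> space M. \<forall>k. names f a (2 * k + 1) ((g ^^ k) y) = names f a (2 * k + 1) ((g ^^ k) x)} F \<and>
       card F \<le> exp (t * real n)"
  shows "rate f p \<le> rate f a"
proof (rule field_le_epsilon)
  fix e :: real assume e: "e > 0"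
  have fs: "f x \<in> space M" and gs: "g x \<in> space M" if "x \<in> space M" for x
    using mpt_measurable[OF f] mpt_measurable[OF g] that by (auto dest: measurable_space)
  have fi: "(f ^^ i) x \<in> space M" and gi: "(g ^^ i) x \<in> space M" if "x \<in> space M" for i x
    using that fs gs by (induction i) auto
  have gfk: "(g ^^ k) ((f ^^ k) x) = x" if "x \<in> space M" for k x
    using that
  proof (induction k arbitrary: x)
    case (Suc k)
    have "(g ^^ Suc k) ((f ^^ Suc k) x) = (g ^^ k) (g (f ((f ^^ k) x)))"
      by (simp add: funpow_swap1)
    then show ?case using Suc gf fi by simp
  qed simp
  obtain x0 where "x0 \<in> space M" using not_empty by auto
  then have "card R > 0" using R by (metis card_gt_0_iff empty_iff)
  define r where "r = real (card R)"
  have r: "r \<ge> 1" using \<open>card R > 0\<close> by (simp add: r_def)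
  \<comment> \<open>With at most \<open>r\<close> labels in the exceptional set and \<open>2 * r\<close> labels altogether, the bound of
    \<open>cond_ent_names_small\<close> is at most \<open>r * s + \<tau> * c\<close> per letter. First \<open>s\<close> and then, depending
    on \<open>s\<close>, the number \<open>\<tau>\<close> is chosen to make each summand at most \<open>e / 2\<close>.\<close>
  define s where "s = min 1 (e / (2 * r))"
  have s: "0 < s" "s \<le> 1" "r * s \<le> e / 2"
  proof -
    have "r * s \<le> r * (e / (2 * r))" using r by (intro mult_left_mono) (auto simp: s_def)
    then show "r * s \<le> e / 2" using r by simp
  qed (use e r in \<open>auto simp: s_def\<close>)
  define c where "c = 2 + ln (1 / s) + 2 * ln (2 * r)"
  have c: "c > 0" unfolding c_def using s r by (intro add_pos_nonneg) auto
  define \<tau> where "\<tau> = e / (2 * c)"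
  have \<tau>: "\<tau> > 0" "\<tau> * c = e / 2" using e c by (auto simp: \<tau>_def)
  have tau2: "\<tau>\<^sup>2 > 0" using \<tau> by simp
  obtain p' :: "'a \<Rightarrow> 'b \<times> bool" and \<delta> :: real where p': "discrete_rv p'" "\<And>x. fst (p' x) = p x"
    and B: "prob {x \<in> space M. p' x \<in> R \<times> {False}} \<le> \<tau>\<^sup>2" and \<delta>: "\<delta> > 0"
    and sep: "\<And>x y. x \<in> space M \<Longrightarrow> y \<in> space M \<Longrightarrow> p' x \<notin> R \<times> {False} \<Longrightarrow> p' y \<notin> R \<times> {False} \<Longrightarrow>
       dist x y \<le> 2 * \<delta> \<Longrightarrow> p' x = p' y"
    by (rule well_separated_refinement[OF p R tau2], assumption, rule that)
  define b where "b k x = names f a (2 * k + 1) ((g ^^ k) x)" for k x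
  have b: "discrete_rv (b k)" for k
    unfolding b_def by (intro mpt_discrete_rv[OF mpt_funpow[OF g]] discrete_rv_names f a)
  have R': "finite (R \<times> (UNIV :: bool set))" "\<And>x. x \<in> space M \<Longrightarrow> p' x \<in> R \<times> UNIV"
    using R p'(2) by (auto simp: mem_Times_iff)
  have B': "finite (R \<times> {False})" using R by simp
  have refine: "b k x = b k y" if "x \<in> space M" "y \<in> space M" "b (Suc k) x = b (Suc k) y" for k x y
  proof -
    have shift: "(f ^^ Suc i) ((g ^^ Suc k) z) = (f ^^ i) ((g ^^ k) z)" if "z \<in> space M" for i z
    proof -
      have "(f ^^ Suc i) ((g ^^ Suc k) z) = (f ^^ i) (f (g ((g ^^ k) z)))"
        by (simp add: funpow_swap1[of f])
      then show ?thesis using fg gi that by simp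
    qed
    have "a ((f ^^ i) ((g ^^ k) x)) = a ((f ^^ i) ((g ^^ k) y))" if i: "i < 2 * k + 1" for i
    proof -
      have "a ((f ^^ Suc i) ((g ^^ Suc k) x)) = a ((f ^^ Suc i) ((g ^^ Suc k) y))"
        using \<open>b (Suc k) x = b (Suc k) y\<close> i unfolding b_def names_eq_iff by (auto simp del: funpow.simps)
      then show ?thesis using shift \<open>x \<in> space M\<close> \<open>y \<in> space M\<close> by metis
    qed
    then show ?thesis unfolding b_def names_eq_iff by blast
  qed
  have span': "AE x in M. \<forall>\<^sub>F n in sequentially. \<exists>F. finite F \<and>
       spanning_set (space M) f n \<delta> {y \<in> space M. \<forall>k. b k y = b k x} F \<and> card F \<le> exp (\<tau> * real n)"
    using span by (rule eventually_mono) (use \<delta> \<tau>(1) in \<open>simp add: b_def\<close>)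
  obtain N k where N: "N > 0" and small: "cond_ent (names f p' N) (b k) \<le>
      ennreal (real N * (2 * \<tau> + ln (1 + card (R \<times> {False}) * s) + \<tau> * ln (1 / s) +
        2 * \<tau> * ln (card (R \<times> (UNIV :: bool set)))))"
    by (rule cond_ent_names_small[OF f p'(1) R' \<tau>(1) s(1,2) B' B sep b refine span']) (assumption | rule that)+
  have bound: "2 * \<tau> + ln (1 + card (R \<times> {False}) * s) + \<tau> * ln (1 / s) +
        2 * \<tau> * ln (card (R \<times> (UNIV :: bool set))) \<le> e"
  proof -
    have "ln (1 + r * s) \<le> r * s" using s r by (intro ln_add_one_self_le_self) auto
    moreover have "2 * \<tau> + \<tau> * ln (1 / s) + 2 * \<tau> * ln (2 * r) = \<tau> * c"
      by (simp add: c_def algebra_simps)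
    ultimately show ?thesis
      using s(3) \<tau>(2) by (simp add: card_cartesian_product r_def mult.commute)
  qed
  have entp: "ent p < \<infinity>"
    using le_less_trans[OF ent_le_ln_card[OF p R]] by simp
  show "rate f p \<le> rate f a + e"
  proof (rule rate_le[OF f p entp a N less_imp_le[OF e]])
    fix n
    have "ent (names f p (n * N)) \<le>
        ent (names f a (n * N + (2 * k + 1))) + of_nat n * cond_ent (names f p N) (b k)"
      by (rule ent_names_block_le[OF f p a(1) b]) (simp add: b_def gfk)
    also have "\<dots> \<le> ent (names f a (n * N + (2 * k + 1))) + of_nat n * ennreal (real N * e)"
    proof (intro add_left_mono mult_left_mono)
      have "cond_ent (names f p N) (b k) \<le> cond_ent (names f p' N) (b k)"
        by (intro cond_ent_mono discrete_rv_names f p p' b) (simp add: names_eq_iff p'(2)[symmetric])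
      also note small
      also have "ennreal (real N * (2 * \<tau> + ln (1 + card (R \<times> {False}) * s) + \<tau> * ln (1 / s) +
          2 * \<tau> * ln (card (R \<times> (UNIV :: bool set))))) \<le> ennreal (real N * e)"
        using bound by (intro ennreal_leI mult_left_mono) auto
      finally show "cond_ent (names f p N) (b k) \<le> ennreal (real N * e)" .
    qed simp
    finally show "ent (names f p (n * N)) \<le>
        ent (names f a (n * N + (2 * k + 1))) + of_nat n * ennreal (real N * e)" .
  qed
qed

end

lemma (in prob_space) finite_partition_of_rv:
  fixes a :: "'a \<Rightarrow> 'b::countable"
  assumes a: "discrete_rv a" and fin: "finite (range a)"
  defines "\<Q> \<equiv> (\<lambda>v. {x \<in> space M. a x = v}) ` range a - {{}}"
  shows "finite \<Q>" "measurable_partition M \<Q>" "partition_on (space M) \<Q>"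
    "x \<in> space M \<Longrightarrow> {y \<in> space M. a y = a x} = atom \<Q> x"
proof -
  show finQ: "finite \<Q>" unfolding \<Q>_def using fin by auto
  show part: "partition_on (space M) \<Q>"
    by (rule partition_onI) (auto simp: \<Q>_def disjnt_def)
  have sub: "\<Q> \<subseteq> events" unfolding \<Q>_def using discrete_rv_level[OF a] by auto
  have "atom \<Q> x = atom \<Q> y \<longleftrightarrow> (\<forall>S\<in>\<Q>. x \<in> S \<longleftrightarrow> y \<in> S)" if "x \<in> space M" "y \<in> space M" for x y
  proof
    assume eq: "atom \<Q> x = atom \<Q> y"
    show "\<forall>S\<in>\<Q>. x \<in> S \<longleftrightarrow> y \<in> S"
      using eq atom_eqI[OF part] in_atom[OF part that(1)] in_atom[OF part that(2)] by metis
  next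
    assume "\<forall>S\<in>\<Q>. x \<in> S \<longleftrightarrow> y \<in> S"
    then show "atom \<Q> x = atom \<Q> y"
      using atom_eqI[OF part] in_atom[OF part that(1)] atom_in[OF part that(1)] by metis
  qed
  then show "measurable_partition M \<Q>"
    unfolding measurable_partition_def using part sub countable_finite[OF finQ]
    by (intro conjI bexI[of _ "{}"] exI[of _ \<Q>]) auto
  show "{y \<in> space M. a y = a x} = atom \<Q> x" if "x \<in> space M"
    by (rule atom_eqI[OF part, symmetric]) (use that in \<open>auto simp: \<Q>_def\<close>)
qed

lemma (in prob_space) AE_positive_atom_finite:
  assumes part: "partition_on (space M) \<P>" "\<P> \<subseteq> events" and fin: "finite \<P>"
  shows "AE x in M. 0 < measure M (atom \<P> x)"
proof -
  have "AE x in M. \<forall>A\<in>\<P>. prob A = 0 \<longrightarrow> x \<notin> A"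
  proof (rule AE_finite_allI[OF fin])
    fix A assume "A \<in> \<P>"
    show "AE x in M. prob A = 0 \<longrightarrow> x \<notin> A"
    proof (cases "prob A = 0")
      case True
      then show ?thesis using \<open>A \<in> \<P>\<close> part(2) by (auto simp: prob_eq_0)
    qed auto
  qed
  then show ?thesis
    using AE_space
  proof eventually_elim
    case (elim x)
    then show ?case
      using atom_in[OF part(1), of x] in_atom[OF part(1), of x] by (auto simp: zero_less_measure_iff)
  qed
qed

theorem theorem5:
  fixes M :: "'a::metric_space set" and d :: nat and f :: "'a \<Rightarrow> 'a"
    and \<mu> :: "'a measure" and \<A> :: "'a set set"
  assumes "compact M" and "topological_manifold d (top_of_set M)"
    and "\<exists>g. homeomorphism M M f g"
    and "prob_space \<mu>" and "sets \<mu> = sets (restrict_space borel M)"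
    and "distr \<mu> \<mu> f = \<mu>"
    and "metric_entropy \<mu> f < \<infinity>"
    and "measurable_partition \<mu> \<A>" and "partition_entropy \<mu> \<A> < \<infinity>"
    and "expansive_measure \<mu> f \<A>"
  shows "metric_entropy \<mu> f = entropy_wrt \<mu> f \<A>"
proof -
  have M: "space \<mu> = M"
    using sets_eq_imp_space_eq[OF assms(5)] by (simp add: space_restrict_space)
  interpret compact_prob_space \<mu>
    using assms(1,4,5) by (simp add: compact_prob_space_def compact_prob_space_axioms_def M)
  obtain h where h: "homeomorphism M M f h" using assms(3) by blast
  define g where "g = inv_into M f"
  have f_img: "f ` M = M" and h_img: "h ` M = M" and cf: "continuous_on M f" and ch: "continuous_on M h"
    and hf: "\<And>x. x \<in> M \<Longrightarrow> h (f x) = x" and fh: "\<And>x. x \<in> M \<Longrightarrow> f (h x) = x"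
    using h by (auto simp: homeomorphism_def)
  have inj: "inj_on f M" by (metis hf inj_on_inverseI)
  have fM: "f x \<in> M" if "x \<in> M" for x using f_img that by blast
  have gM: "g x \<in> M" if "x \<in> M" for x unfolding g_def using f_img that by (metis inv_into_into)
  have gf: "g (f x) = x" if "x \<in> M" for x unfolding g_def using inj that by simp
  have fg: "f (g x) = x" if "x \<in> M" for x unfolding g_def using f_img that by (metis f_inv_into_f)
  have gh: "g x = h x" if "x \<in> M" for x using that by (metis fh gf h_img imageI)
  have cg: "continuous_on M g" using ch gh by (simp cong: continuous_on_cong)
  have meas: "k \<in> measurable \<mu> \<mu>" if "continuous_on M k" "\<And>x. x \<in> M \<Longrightarrow> k x \<in> M" for k
  proof -
    have "k \<in> measurable (restrict_space borel M) (restrict_space borel M)"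
      using that by (intro measurable_restrict_space2 borel_measurable_continuous_on_restrict)
        (auto simp: space_restrict_space)
    then show ?thesis using measurable_cong_sets[OF assms(5) assms(5)] by simp
  qed
  have mf: "f \<in> measurable \<mu> \<mu>" and mg: "g \<in> measurable \<mu> \<mu>"
    using meas[OF cf fM] meas[OF cg gM] by auto
  have f: "mpt f" using mf assms(6) by (simp add: mpt_def)
  have g: "mpt g"
  proof -
    have "distr \<mu> \<mu> g = distr (distr \<mu> \<mu> f) \<mu> g" by (simp add: assms(6))
    also have "\<dots> = distr \<mu> \<mu> (g \<circ> f)" by (rule distr_distr[OF mg mf])
    also have "\<dots> = distr \<mu> \<mu> (\<lambda>x. x)" by (rule distr_cong) (auto simp: M gf)
    also have "\<dots> = \<mu>" by (simp add: distr_id)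
    finally show ?thesis using mg by (simp add: mpt_def)
  qed
  have fi: "(f ^^ i) x \<in> M" and gi: "(g ^^ i) x \<in> M" if "x \<in> M" for i x
    using that fM gM by (induction i) auto
  have fgk: "(f ^^ k) ((g ^^ k) x) = x" if "x \<in> M" for k x
    using that
  proof (induction k arbitrary: x)
    case (Suc k)
    have "(f ^^ Suc k) ((g ^^ Suc k) x) = (f ^^ k) (f (g ((g ^^ k) x)))"
      by (simp add: funpow_swap1)
    then show ?case using Suc fg gi by simp
  qed simp
  have A: "partition_on (space \<mu>) \<A>" "\<A> \<subseteq> events"
    using assms(8) by (auto simp: measurable_partition_def)
  have pos: "AE x in \<mu>. 0 < measure \<mu> (atom \<A> x)"
    using assms(9) unfolding partition_entropy_def by (auto split: if_splits)
  obtain a :: "'a \<Rightarrow> nat" where a: "discrete_rv a" "AE x in \<mu>. a x \<noteq> 0"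
    "\<And>x. x \<in> space \<mu> \<Longrightarrow> a x \<noteq> 0 \<Longrightarrow> {y \<in> space \<mu>. a y = a x} = atom \<A> x"
    by (rule partition_label[OF A pos]) (rule that)
  have lev: "AE x in \<mu>. {y \<in> space \<mu>. a y = a x} = atom \<A> x"
    using a(2) AE_space by eventually_elim (rule a(3))
  have ent_a: "ent a < \<infinity>"
    using partition_entropy_eq_ent[OF A(1) a(1) lev] assms(9) by simp
  have hA: "entropy_wrt \<mu> f \<A> = ennreal (rate f a)"
    by (rule entropy_wrt_eq_rate[OF A(1) f a(1) ent_a lev])
  show ?thesis
  proof (rule antisym)
    show "entropy_wrt \<mu> f \<A> \<le> metric_entropy \<mu> f"
    proof (rule ennreal_le_epsilon)
      fix e :: real assume e: "e > 0"
      obtain K where K: "cond_ent a (\<lambda>x. min (a x) K) \<le> ennreal e"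
        using cond_ent_truncate_small[OF a(1) ent_a e] by blast
      \<comment> \<open>The level sets of the truncated label form a finite partition whose entropy is almost that
        of \<open>\<A>\<close>.\<close>
      define aK where "aK x = min (a x) K" for x
      have aK: "discrete_rv aK" unfolding aK_def by (rule discrete_rv_fun[OF a(1)]) simp
      have "range aK \<subseteq> {..K}" by (auto simp: aK_def)
      then have fin: "finite (range aK)" by (rule finite_subset) simp
      have ent_aK: "ent aK < \<infinity>"
        using le_less_trans[OF ent_mono[OF aK a(1)] ent_a] by (simp add: aK_def)
      note Q = finite_partition_of_rv[OF aK fin]
      have "ennreal (rate f aK) \<le> metric_entropy \<mu> f"
        unfolding metric_entropy_def
        by (subst entropy_wrt_eq_rate[OF Q(3) f aK ent_aK AE_I2[OF Q(4)], symmetric])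
          (use Q(1,2) in \<open>auto intro!: SUP_upper\<close>)
      moreover have "rate f a \<le> rate f aK + e"
        using K e by (intro rate_le_cond_ent f a(1) ent_a aK ent_aK) (auto simp: aK_def[abs_def])
      then have "ennreal (rate f a) \<le> ennreal (rate f aK) + ennreal e"
        using rate_LIMSEQ(2)[OF f aK ent_aK] e by (simp add: ennreal_plus[symmetric] ennreal_leI del: ennreal_plus)
      ultimately show "entropy_wrt \<mu> f \<A> \<le> metric_entropy \<mu> f + ennreal e"
        unfolding hA by (meson add_right_mono order_trans)
    qed
    have span: "AE x in \<mu>. \<forall>\<delta>>0. \<forall>t>0. \<forall>\<^sub>F n in sequentially. \<exists>F. finite F \<and>
       spanning_set (space \<mu>) f n \<delta>
         {y \<in> space \<mu>. \<forall>k. names f a (2 * k + 1) ((g ^^ k) y) = names f a (2 * k + 1) ((g ^^ k) x)} F \<and>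
       card F \<le> exp (t * real n)"
    proof -
      have "AE x in \<mu>. \<forall>i. a ((f ^^ i) x) \<noteq> 0" "AE x in \<mu>. \<forall>i. a ((g ^^ i) x) \<noteq> 0"
        using mpt_AE[OF mpt_funpow[OF f] a(2)] mpt_AE[OF mpt_funpow[OF g] a(2)]
        by (simp_all add: AE_all_countable)
      moreover have "AE x in \<mu>. tail_entropy M f x \<A> = 0"
        using assms(10) by (simp add: expansive_measure_def M)
      ultimately show ?thesis
        using AE_space
      proof eventually_elim
        case (elim x)
        let ?Z = "{y \<in> space \<mu>. \<forall>k. names f a (2 * k + 1) ((g ^^ k) y) = names f a (2 * k + 1) ((g ^^ k) x)}"
        have x: "x \<in> M" using elim by (simp add: M)
        \<comment> \<open>Along the orbit of \<open>x\<close> no label is 0, so equality of labels means to be in the same element of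
          the partition.\<close>
        have sub: "?Z \<subseteq> infinity_ball M f \<A> x"
        proof
          fix y assume "y \<in> ?Z"
          then have y: "y \<in> M" and eq: "\<And>k i. i < 2 * k + 1 \<Longrightarrow> a ((f ^^ i) ((g ^^ k) y)) = a ((f ^^ i) ((g ^^ k) x))"
            unfolding names_eq_iff by (auto simp: M)
          have "int_iterate M f n y \<in> atom \<A> (int_iterate M f n x)" for n
          proof -
            have it_M: "int_iterate M f n z \<in> M" if "z \<in> M" for z
              using that fi gi by (auto simp: int_iterate_def g_def)
            have "a (int_iterate M f n y) = a (int_iterate M f n x) \<and> a (int_iterate M f n x) \<noteq> 0"
            proof (cases "0 \<le> n")
              case True
              define k where "k = nat n"
              have "(f ^^ (2 * k)) ((g ^^ k) z) = (f ^^ k) z" if "z \<in> M" for z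
                using fgk[OF that, of k] by (simp add: mult_2 funpow_add)
              then show ?thesis
                using eq[of "2 * k" k] elim(1) True x y by (simp add: int_iterate_def k_def)
            next
              case False
              then show ?thesis
                using eq[of 0 "nat (- n)"] elim(2) by (simp add: int_iterate_def g_def)
            qed
            then show ?thesis
              using a(3)[of "int_iterate M f n x"] it_M[OF x] it_M[OF y] by (auto simp: M)
          qed
          with y show "y \<in> infinity_ball M f \<A> x" by (auto simp: infinity_ball_def)
        qed
        have ball: "infinity_ball M f \<A> x \<subseteq> M" by (auto simp: infinity_ball_def)
        show ?case
        proof (intro allI impI)
          fix \<delta> t :: real assume "\<delta> > 0" "t > 0"
          have "top_entropy M f (infinity_ball M f \<A> x) = 0"
            using elim(3) by (simp add: tail_entropy_def)
          from top_entropy_0_spanning[OF assms(1) cf _ ball this \<open>\<delta> > 0\<close> \<open>t > 0\<close>] fM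
          have "\<forall>\<^sub>F n in sequentially. \<exists>F. finite F \<and>
              spanning_set M f n \<delta> (infinity_ball M f \<A> x) F \<and> card F \<le> exp (t * real n)"
            by blast
          then show "\<forall>\<^sub>F n in sequentially. \<exists>F. finite F \<and> spanning_set (space \<mu>) f n \<delta> ?Z F \<and>
              card F \<le> exp (t * real n)"
          proof (rule eventually_mono)
            fix n assume "\<exists>F. finite F \<and>
              spanning_set M f n \<delta> (infinity_ball M f \<A> x) F \<and> card F \<le> exp (t * real n)"
            then obtain F where F: "finite F" "spanning_set M f n \<delta> (infinity_ball M f \<A> x) F"
              "card F \<le> exp (t * real n)" by blast
            then have "spanning_set M f n \<delta> ?Z F"
              using sub unfolding spanning_set_def by (meson subsetD)
            then show "\<exists>F. finite F \<and> spanning_set (space \<mu>) f n \<delta> ?Z F \<and> card F \<le> exp (t * real n)"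
              using F unfolding M by blast
          qed
        qed
      qed
    qed
    show "metric_entropy \<mu> f \<le> entropy_wrt \<mu> f \<A>"
      unfolding metric_entropy_def
    proof (rule SUP_least)
      fix \<P> assume "\<P> \<in> {\<P>. finite \<P> \<and> measurable_partition \<mu> \<P>}"
      then have P: "finite \<P>" "partition_on (space \<mu>) \<P>" "\<P> \<subseteq> events"
        by (auto simp: measurable_partition_def)
      obtain p :: "'a \<Rightarrow> nat" where p: "discrete_rv p" "AE x in \<mu>. p x \<noteq> 0"
        "\<And>x. x \<in> space \<mu> \<Longrightarrow> p x \<noteq> 0 \<Longrightarrow> {y \<in> space \<mu>. p y = p x} = atom \<P> x"
        "finite (range p)"
        by (rule partition_label[OF P(2,3) AE_positive_atom_finite[OF P(2,3,1)]])
          (rule that; (assumption | simp add: P(1)))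
      have lev_p: "AE x in \<mu>. {y \<in> space \<mu>. p y = p x} = atom \<P> x"
        using p(2) AE_space by eventually_elim (rule p(3))
      have ent_p: "ent p < \<infinity>"
        using le_less_trans[OF ent_le_ln_card[OF p(1,4)]] by simp
      have "entropy_wrt \<mu> f \<P> = ennreal (rate f p)"
        by (rule entropy_wrt_eq_rate[OF P(2) f p(1) ent_p lev_p])
      also have "\<dots> \<le> ennreal (rate f a)"
        using fg gf M span by (intro ennreal_leI rate_le_of_spanning[OF f g _ _ p(1,4) _ a(1) ent_a]) auto
      finally show "entropy_wrt \<mu> f \<P> \<le> entropy_wrt \<mu> f \<A>" by (simp add: hA)
    qed
  qed
qed

end
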